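(* Let $\mathcal{A}$ be a unital $C^*$-algebra, $\mathcal{E}$ a right Hilbert $\mathcal{A}$-module, $H_1,H_2$ Hilbert spaces, $\varphi:\mathcal{A}\to\mathcal{B}(H_1)$ a completely positive map and $\Phi:\mathcal{E}\to\mathcal{B}(H_1,H_2)$ a completely semi-$\varphi$-map. Assume $((\rho,K_1,V),(\Psi,K_2,W))$ and $((\pi,L_1,U),(\Gamma,L_2,S))$ are two minimal dilation pairs for $(\varphi,\Phi)$. Then there exist unitary operators $T_1:K_1\to L_1$ and $T_2:K_2\to L_2$ such that (i) $T_1V=U$ and $T_1\rho(a)=\pi(a)T_1$ for all $a\in\mathcal{A}$. (ii) $T_2W=S$ and $T_2\Psi(x)=\Gamma(x)T_1$ for all $x\in\mathcal{E}$. (iii) $\begin{bmatrix}T_2&0\\ 0&T_1\end{bmatrix}\begin{bmatrix}W&0\\ 0&V\end{bmatrix}=\begin{bmatrix}S&0\\ 0&U\end{bmatrix}$ and $\begin{bmatrix}T_2&0\\ 0&T_1\end{bmatrix}\begin{bmatrix}\sigma&\Psi\\ \Psi^*&\rho\end{bmatrix}\begin{bmatrix}T_2^*&0\\ 0&T_1^*\end{bmatrix}=\begin{bmatrix}\tau&\Gamma\\ \Gamma^*&\pi\end{bmatrix}$, where $\sigma:\mathbb{K}_1(\mathcal{E})\to\mathcal{B}(K_2)$ and $\tau:\mathbb{K}_1(\mathcal{E})\to\mathcal{B}(L_2)$ are the unique $*$-homomorphisms satisfying $\sigma(x\otimes y)=\Psi(x)\Psi(y)^*$ and $\tau(x\otimes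 y)=\Gamma(x)\Gamma(y)^*$ for all $x,y\in\mathcal{E}$. Consequently, the representations $\rho$, $\begin{bmatrix}\sigma&\Psi\\ \Psi^*&\rho\end{bmatrix}$ and $\sigma$ are unitarily equivalent to the representations $\pi$, $\begin{bmatrix}\tau&\Gamma\\ \Gamma^*&\pi\end{bmatrix}$ and $\tau$, respectively.
   Context: $\mathbb{M}_n(\mathcal{E})$ is a right Hilbert $\mathbb{M}_n(\mathcal{A})$-module with $\langle (x_{ij}),(y_{ij})\rangle=(\sum_k\langle x_{ki},y_{kj}\rangle)$ and $(x_{ij})\cdot(a_{ij})=(\sum_k x_{ik}a_{kj})$; $\Phi_n,\varphi_n$ are entrywise amplifications. A linear map $\Phi:\mathcal{E}\to\mathcal{B}(H_1,H_2)$ is a completely semi-$\varphi$-map if $\Phi_n(x)^*\Phi_n(x)\le\varphi_n(\langle x,x\rangle)$ for all $n\in\mathbb{N}$, $x\in\mathbb{M}_n(\mathcal{E})$. A dilation pair for $(\varphi,\Phi)$ is a pair of triples $((\rho,K_1,V),(\Psi,K_2,W))$ consisting of Hilbert spaces $K_1,K_2$, a unital $*$-representation $\rho:\mathcal{A}\to\mathcal{B}(K_1)$, a $\rho$-map $\Psi:\mathcal{E}\to\mathcal{B}(K_1,K_2)$ (a linear map with $\Psi(x)^*\Psi(y)=\rho(\langle x,y\rangle)$ for all $x,y\in\mathcal{E}$), and bounded operators $V:H_1\to K_1$, $W:H_2\to K_2$ such that $\Phi(x)=W^*\Psi(x)V$ and $\varphi(a)=V^*\rho(a)V$ for all $a\in\mathcal{A}$,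 $x\in\mathcal{E}$. It is minimal if $[\rho(\mathcal{A})VH_1]=K_1$ and $\Psi$ is non-degenerate, i.e. $[\Psi(\mathcal{E})K_1]=K_2$, where $[\cdot]$ denotes closed linear span. $\mathbb{K}(\mathcal{E})$ is the algebra of compact operators on $\mathcal{E}$, $\mathbb{K}_1(\mathcal{E})=\mathbb{K}(\mathcal{E})+\mathbb{C}I_{\mathcal{E}}$, and $x\otimes y$ is the rank-one operator $z\mapsto x\langle y,z\rangle$. The linking algebra is $\mathcal{L}_1(\mathcal{E})=\left\{\begin{bmatrix}u&x\\ y^*&a\end{bmatrix}: a\in\mathcal{A},\,u\in\mathbb{K}_1(\mathcal{E}),\,x,y\in\mathcal{E}\right\}$, and $\begin{bmatrix}\sigma&\Psi\\ \Psi^*&\rho\end{bmatrix}$ denotes the map $\begin{bmatrix}u&x\\ y^*&a\end{bmatrix}\mapsto\begin{bmatrix}\sigma(u)&\Psi(x)\\ \Psi(y)^*&\rho(a)\end{bmatrix}$ from $\mathcal{L}_1(\mathcal{E})$ to $\mathcal{B}(K_2\oplus K_1)$; similarly for $\begin{bmatrix}\tau&\Gamma\\ \Gamma^*&\pi\end{bmatrix}$. *)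

theory Defs
  imports "HOL-Analysis.Analysis" "HOL-Library.Complex_Order"
begin

class complex_vector = real_vector +
  fixes scaleC :: "complex \<Rightarrow> 'a \<Rightarrow> 'a"  (infixr \<open>*\<^sub>C\<close> 75)
  assumes scaleC_add_right: "c *\<^sub>C (x + y) = c *\<^sub>C x + c *\<^sub>C y"
    and scaleC_add_left: "(c + d) *\<^sub>C x = c *\<^sub>C x + d *\<^sub>C x"
    and scaleC_scaleC: "c *\<^sub>C d *\<^sub>C x = (c * d) *\<^sub>C x"
    and scaleC_one: "1 *\<^sub>C x = x"
    and scaleR_scaleC: "r *\<^sub>R x = complex_of_real r *\<^sub>C x"

global_interpretation complex_vector:
  vector_space "scaleC :: complex \<Rightarrow> 'a \<Rightarrow> 'a::complex_vector"
  defines cspan = complex_vector.span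
  by unfold_locales
    (simp_all add: scaleC_add_right scaleC_add_left scaleC_scaleC scaleC_one)

definition clinear :: "('a::complex_vector \<Rightarrow> 'b::complex_vector) \<Rightarrow> bool" where
  "clinear f \<longleftrightarrow> Vector_Spaces.linear scaleC scaleC f"

class complex_normed_vector = real_normed_vector + complex_vector +
  assumes norm_scaleC: "norm (c *\<^sub>C x) = cmod c * norm x"

lemma bounded_linear_scaleC: "bounded_linear ((*\<^sub>C) c :: 'a \<Rightarrow> 'a::complex_normed_vector)"
  by (rule bounded_linear_intro[of _ "cmod c"])
    (simp_all add: scaleC_add_right scaleR_scaleC scaleC_scaleC mult.commute norm_scaleC)

class cbanach = complex_normed_vector + complete_space

text \<open>The inner product is conjugate-linear in the first variable, in accordance with
  the convention for right Hilbert modules.\<close>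

class complex_inner = complex_normed_vector +
  fixes cinner :: "'a \<Rightarrow> 'a \<Rightarrow> complex"
  assumes cinner_commute: "cinner x y = cnj (cinner y x)"
    and cinner_add_right: "cinner x (y + z) = cinner x y + cinner x z"
    and cinner_scaleC_right: "cinner x (c *\<^sub>C y) = c * cinner x y"
    and cinner_ge_zero: "0 \<le> cinner x x"
    and norm_eq_sqrt_cinner: "norm x = sqrt (cmod (cinner x x))"

class chilbert_space = complex_inner + complete_space

text \<open>The zero algebra is not excluded.\<close>

class unital_cstar_algebra = cbanach + real_normed_algebra + monoid_mult +
  fixes star :: "'a \<Rightarrow> 'a"
  assumes mult_scaleC_left: "(c *\<^sub>C a) * b = c *\<^sub>C (a * b)"
    and mult_scaleC_right: "a * (c *\<^sub>C b) = c *\<^sub>C (a * b)"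
    and star_star: "star (star a) = a"
    and star_add: "star (a + b) = star a + star b"
    and star_scaleC: "star (c *\<^sub>C a) = cnj c *\<^sub>C star a"
    and star_mult: "star (a * b) = star b * star a"
    and cstar_identity: "norm (star a * a) = (norm a)\<^sup>2"

instantiation prod :: (complex_vector, complex_vector) complex_vector
begin

definition scaleC_prod :: "complex \<Rightarrow> 'a \<times> 'b \<Rightarrow> 'a \<times> 'b" where
  "scaleC_prod c x = (c *\<^sub>C fst x, c *\<^sub>C snd x)"

instance
  by standard
    (auto simp: scaleC_prod_def scaleC_add_right scaleC_add_left scaleC_scaleC scaleC_one
      scaleR_scaleC prod_eq_iff)

end

instance prod :: (complex_normed_vector, complex_normed_vector) complex_normed_vector
proof
  fix c and x :: "'a \<times> 'b"
  have "(norm (c *\<^sub>C x))\<^sup>2 = (cmod c * norm x)\<^sup>2"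
    by (simp add: norm_prod_def scaleC_prod_def norm_scaleC power_mult_distrib algebra_simps)
  then show "norm (c *\<^sub>C x) = cmod c * norm x"
    by (rule power2_eq_imp_eq) simp_all
qed

instance prod :: (cbanach, cbanach) cbanach ..

lemma cmod_cinner_self: "complex_of_real (cmod (cinner x x)) = cinner x x"
proof -
  have "0 \<le> cinner x x" by (rule cinner_ge_zero)
  then show ?thesis by (simp add: less_eq_complex_def complex_eq_iff cmod_eq_Re)
qed

instantiation prod :: (complex_inner, complex_inner) complex_inner
begin

definition cinner_prod :: "'a \<times> 'b \<Rightarrow> 'a \<times> 'b \<Rightarrow> complex" where
  "cinner_prod x y = cinner (fst x) (fst y) + cinner (snd x) (snd y)"

instance
proof
  fix x y z :: "'a \<times> 'b" and c
  show "cinner x y = cnj (cinner y x)"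
    by (simp add: cinner_prod_def cinner_commute[symmetric])
  show "cinner x (y + z) = cinner x y + cinner x z"
    by (simp add: cinner_prod_def cinner_add_right)
  show "cinner x (c *\<^sub>C y) = c * cinner x y"
    by (simp add: cinner_prod_def scaleC_prod_def cinner_scaleC_right algebra_simps)
  show "0 \<le> cinner x x"
    by (simp add: cinner_prod_def cinner_ge_zero)
  have "cmod (cinner x x) =
      cmod (complex_of_real (cmod (cinner (fst x) (fst x)) + cmod (cinner (snd x) (snd x))))"
    by (simp add: cinner_prod_def cmod_cinner_self)
  also have "\<dots> = cmod (cinner (fst x) (fst x)) + cmod (cinner (snd x) (snd x))"
    by (subst norm_of_real) simp
  finally show "norm x = sqrt (cmod (cinner x x))"
    by (simp add: norm_prod_def norm_eq_sqrt_cinner)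
qed

end

instance prod :: (chilbert_space, chilbert_space) chilbert_space ..

typedef (overloaded) ('a, 'b) cblinfun =
  "{T :: 'a::complex_normed_vector \<Rightarrow>\<^sub>L 'b::complex_normed_vector.
      \<forall>c x. blinfun_apply T (c *\<^sub>C x) = c *\<^sub>C blinfun_apply T x}"
  morphisms blinfun_of_cblinfun cblinfun_of_blinfun
  by (rule exI[of _ 0]) (simp add: complex_vector.scale_zero_right)

setup_lifting type_definition_cblinfun

lift_definition capply ::
  "('a::complex_normed_vector, 'b::complex_normed_vector) cblinfun \<Rightarrow> 'a \<Rightarrow> 'b"
  (infixr \<open>*\<^sub>V\<close> 70) is blinfun_apply .

lemma cblinfun_eqI: "(\<And>x. S *\<^sub>V x = T *\<^sub>V x) \<Longrightarrow> S = T"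
  by transfer (rule blinfun_eqI)

text \<open>The operator with a given graph; only meaningful if \<open>f\<close> is bounded and
  complex-linear.\<close>

definition CBlinfun :: "('a::complex_normed_vector \<Rightarrow> 'b::complex_normed_vector) \<Rightarrow> ('a, 'b) cblinfun" where
  "CBlinfun f = (THE T. \<forall>x. T *\<^sub>V x = f x)"

lemma CBlinfun_apply:
  assumes "clinear f" "bounded_linear f"
  shows "CBlinfun f *\<^sub>V x = f x"
proof -
  have f: "blinfun_apply (Blinfun f) = f"
    by (rule bounded_linear_Blinfun_apply[OF assms(2)])
  have s: "f (c *\<^sub>C x) = c *\<^sub>C f x" for c x
    using assms(1) unfolding clinear_def Vector_Spaces.linear_def module_hom_def
      module_hom_axioms_def by blast
  have "capply (cblinfun_of_blinfun (Blinfun f)) = f"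
    unfolding capply.rep_eq by (subst cblinfun_of_blinfun_inverse) (simp_all add: f s)
  then have "\<exists>!T. \<forall>x. T *\<^sub>V x = f x"
    by (metis cblinfun_eqI)
  then have "\<forall>x. CBlinfun f *\<^sub>V x = f x"
    unfolding CBlinfun_def by (rule theI')
  then show ?thesis by blast
qed

lemma blinfun_scaleC_apply:
  fixes T :: "'a::complex_normed_vector \<Rightarrow>\<^sub>L 'b::complex_normed_vector"
  shows "blinfun_apply (Blinfun (\<lambda>x. c *\<^sub>C blinfun_apply T x)) x = c *\<^sub>C blinfun_apply T x"
  by (simp add: bounded_linear_Blinfun_apply
      bounded_linear_compose[OF bounded_linear_scaleC blinfun.bounded_linear_right])

lemma blinfun_scaleC_commute:
  fixes T :: "'a::complex_normed_vector \<Rightarrow>\<^sub>L 'b::complex_normed_vector"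
  assumes "\<And>d x. blinfun_apply T (d *\<^sub>C x) = d *\<^sub>C blinfun_apply T x"
  shows "blinfun_apply (Blinfun (\<lambda>x. c *\<^sub>C blinfun_apply T x)) (d *\<^sub>C x) =
    d *\<^sub>C blinfun_apply (Blinfun (\<lambda>x. c *\<^sub>C blinfun_apply T x)) x"
  by (simp add: blinfun_scaleC_apply assms scaleC_scaleC mult.commute)

instantiation cblinfun :: (complex_normed_vector, complex_normed_vector) complex_normed_vector
begin

lift_definition zero_cblinfun :: "('a, 'b) cblinfun" is 0
  by (simp add: complex_vector.scale_zero_right)
lift_definition plus_cblinfun :: "('a, 'b) cblinfun \<Rightarrow> ('a, 'b) cblinfun \<Rightarrow> ('a, 'b) cblinfun" is "(+)"
  by (simp add: blinfun.add_left scaleC_add_right)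
lift_definition minus_cblinfun :: "('a, 'b) cblinfun \<Rightarrow> ('a, 'b) cblinfun \<Rightarrow> ('a, 'b) cblinfun" is "(-)"
  by (simp add: blinfun.diff_left complex_vector.scale_right_diff_distrib)
lift_definition uminus_cblinfun :: "('a, 'b) cblinfun \<Rightarrow> ('a, 'b) cblinfun" is uminus
  by (simp add: blinfun.minus_left complex_vector.scale_minus_right)
lift_definition scaleR_cblinfun :: "real \<Rightarrow> ('a, 'b) cblinfun \<Rightarrow> ('a, 'b) cblinfun" is scaleR
  by (simp add: scaleR_blinfun.rep_eq scaleR_scaleC scaleC_scaleC mult.commute
      del: blinfun.scaleR_left)
lift_definition scaleC_cblinfun :: "complex \<Rightarrow> ('a, 'b) cblinfun \<Rightarrow> ('a, 'b) cblinfun"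
  is "\<lambda>c T. Blinfun (\<lambda>x. c *\<^sub>C blinfun_apply T x)"
  by (simp add: blinfun_scaleC_commute)

lift_definition norm_cblinfun :: "('a, 'b) cblinfun \<Rightarrow> real" is norm .

definition dist_cblinfun :: "('a, 'b) cblinfun \<Rightarrow> ('a, 'b) cblinfun \<Rightarrow> real" where
  "dist_cblinfun S T = norm (S - T)"
definition sgn_cblinfun :: "('a, 'b) cblinfun \<Rightarrow> ('a, 'b) cblinfun" where
  "sgn_cblinfun T = scaleR (inverse (norm T)) T"
definition uniformity_cblinfun :: "(('a, 'b) cblinfun \<times> ('a, 'b) cblinfun) filter" where
  "uniformity_cblinfun = (INF e\<in>{0<..}. principal {(S, T). dist S T < e})"
definition open_cblinfun :: "('a, 'b) cblinfun set \<Rightarrow> bool" where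
  "open_cblinfun U = (\<forall>S\<in>U. \<forall>\<^sub>F (S', T) in uniformity. S' = S \<longrightarrow> T \<in> U)"

lemma capply_scaleC: "(c *\<^sub>C T) *\<^sub>V x = c *\<^sub>C (T *\<^sub>V x)"
  for T :: "('a, 'b) cblinfun"
  by (transfer fixing: c x) (rule blinfun_scaleC_apply)

lemma capply_add: "(S + T) *\<^sub>V x = S *\<^sub>V x + T *\<^sub>V x"
  for S T :: "('a, 'b) cblinfun"
  by transfer (simp add: blinfun.add_left)

lemma capply_scaleR: "(r *\<^sub>R T) *\<^sub>V x = r *\<^sub>R (T *\<^sub>V x)"
  for T :: "('a, 'b) cblinfun"
  by transfer (simp add: blinfun.scaleR_left)

lemma norm_capply: "norm (T *\<^sub>V x) \<le> norm T * norm x"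
  for T :: "('a, 'b) cblinfun"
  by transfer (rule norm_blinfun)

lemma norm_cblinfun_le: "0 \<le> b \<Longrightarrow> (\<And>x. norm (T *\<^sub>V x) \<le> b * norm x) \<Longrightarrow> norm T \<le> b"
  for T :: "('a, 'b) cblinfun"
  by transfer (rule norm_blinfun_bound)

instance
proof
  fix S T R :: "('a, 'b) cblinfun" and U :: "('a, 'b) cblinfun set" and a b :: real and c d :: complex
  show "S + T + R = S + (T + R)" "S + T = T + S" "0 + S = S" "- S + S = 0" "S - T = S + - T"
    "a *\<^sub>R (S + T) = a *\<^sub>R S + a *\<^sub>R T" "(a + b) *\<^sub>R S = a *\<^sub>R S + b *\<^sub>R S"
    "a *\<^sub>R b *\<^sub>R S = (a * b) *\<^sub>R S" "1 *\<^sub>R S = S"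
    by (transfer; simp add: algebra_simps)+
  show "dist S T = norm (S - T)" by (rule dist_cblinfun_def)
  show "sgn S = scaleR (inverse (norm S)) S" by (rule sgn_cblinfun_def)
  show "uniformity = (INF e\<in>{0<..}. principal {(S :: ('a, 'b) cblinfun, T). dist S T < e})"
    by (rule uniformity_cblinfun_def)
  show "open U = (\<forall>S\<in>U. \<forall>\<^sub>F (S', T) in uniformity. S' = S \<longrightarrow> T \<in> U)"
    by (rule open_cblinfun_def)
  show "(norm S = 0) = (S = 0)" "norm (a *\<^sub>R S) = \<bar>a\<bar> * norm S"
    by (transfer; simp)+
  show "norm (S + T) \<le> norm S + norm T"
    by transfer (rule norm_triangle_ineq)
  show "c *\<^sub>C (S + T) = c *\<^sub>C S + c *\<^sub>C T" "(c + d) *\<^sub>C S = c *\<^sub>C S + d *\<^sub>C S"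
    "c *\<^sub>C d *\<^sub>C S = (c * d) *\<^sub>C S" "1 *\<^sub>C S = S" "a *\<^sub>R S = complex_of_real a *\<^sub>C S"
    by (rule cblinfun_eqI, simp add: capply_scaleC capply_add capply_scaleR scaleC_add_right
        scaleC_add_left scaleC_scaleC scaleC_one scaleR_scaleC)+
  have nonneg: "0 \<le> norm S" for S :: "('a, 'b) cblinfun"
    by transfer simp
  have le: "norm (c *\<^sub>C S) \<le> cmod c * norm S" for c and S :: "('a, 'b) cblinfun"
    by (rule norm_cblinfun_le)
      (auto simp: capply_scaleC norm_scaleC mult.assoc intro: mult_left_mono norm_capply mult_nonneg_nonneg nonneg)
  show "norm (c *\<^sub>C S) = cmod c * norm S"
  proof (cases "c = 0")
    case True
    then show ?thesis using le[of 0 S] nonneg[of "0 *\<^sub>C S"] by simp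
  next
    case False
    have "inverse c *\<^sub>C c *\<^sub>C S = S"
      by (rule cblinfun_eqI) (simp add: capply_scaleC scaleC_scaleC scaleC_one False)
    then have "norm S \<le> inverse (cmod c) * norm (c *\<^sub>C S)"
      using le[of "inverse c" "c *\<^sub>C S"] by (simp add: norm_inverse)
    moreover have "0 < cmod c" using False by simp
    ultimately have "cmod c * norm S \<le> norm (c *\<^sub>C S)"
      by (simp add: field_simps)
    then show ?thesis using le[of c S] by (rule order_antisym[rotated])
  qed
qed

end

lift_definition cid :: "('a::complex_normed_vector, 'a) cblinfun" is id_blinfun
  by simp

lift_definition ccompose :: "('b::complex_normed_vector, 'c::complex_normed_vector) cblinfun \<Rightarrow>
    ('a::complex_normed_vector, 'b) cblinfun \<Rightarrow> ('a, 'c) cblinfun"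
  (infixl \<open>\<circ>\<^sub>C\<close> 67) is blinfun_compose
  by simp

lemma blinfun_block_apply:
  "blinfun_apply (Blinfun (\<lambda>(x, y). (blinfun_apply A x + blinfun_apply B y,
                                  blinfun_apply C x + blinfun_apply D y))) z =
    (blinfun_apply A (fst z) + blinfun_apply B (snd z),
     blinfun_apply C (fst z) + blinfun_apply D (snd z))"
proof -
  have "bounded_linear (\<lambda>(x, y). (blinfun_apply A x + blinfun_apply B y,
      blinfun_apply C x + blinfun_apply D y))"
    unfolding case_prod_unfold by (intro bounded_linear_intros)
  then show ?thesis
    by (simp add: bounded_linear_Blinfun_apply case_prod_unfold)
qed

text \<open>Operator matrices \<open>[A, B; C, D]\<close> acting between direct sums.\<close>

lift_definition block ::
  "('a::complex_normed_vector, 'c::complex_normed_vector) cblinfun \<Rightarrow>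
   ('b::complex_normed_vector, 'c) cblinfun \<Rightarrow>
   ('a, 'd::complex_normed_vector) cblinfun \<Rightarrow> ('b, 'd) cblinfun \<Rightarrow>
   ('a \<times> 'b, 'c \<times> 'd) cblinfun"
  is "\<lambda>A B C D. Blinfun (\<lambda>(x, y). (blinfun_apply A x + blinfun_apply B y,
                                  blinfun_apply C x + blinfun_apply D y))"
  by (simp add: blinfun_block_apply scaleC_prod_def scaleC_add_right)

lemma block_apply:
  "block A B C D *\<^sub>V (x, y) = (A *\<^sub>V x + B *\<^sub>V y, C *\<^sub>V x + D *\<^sub>V y)"
  by transfer (simp add: blinfun_block_apply)

definition cadj :: "('h::chilbert_space, 'k::chilbert_space) cblinfun \<Rightarrow> ('k, 'h) cblinfun" where
  "cadj T = (THE S. \<forall>x y. cinner (T *\<^sub>V x) y = cinner x (S *\<^sub>V y))"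

definition cunitary :: "('h::chilbert_space, 'k::chilbert_space) cblinfun \<Rightarrow> bool" where
  "cunitary T \<longleftrightarrow> cadj T \<circ>\<^sub>C T = cid \<and> T \<circ>\<^sub>C cadj T = cid"

text \<open>An \<open>n \<times> n\<close> matrix is a function of two indices of which only the values at indices below
  \<open>n\<close> matter; the amplification of \<open>f\<close> is \<open>\<lambda>i j. f (x i j)\<close>.\<close>

type_synonym 'a matrix = "nat \<Rightarrow> nat \<Rightarrow> 'a"

definition amplify :: "('a \<Rightarrow> 'b) \<Rightarrow> 'a matrix \<Rightarrow> 'b matrix" where
  "amplify f x = (\<lambda>i j. f (x i j))"

text \<open>Positivity in the C*-algebra of \<open>n \<times> n\<close> matrices over \<open>'a\<close>: being of the form \<open>b\<^sup>* b\<close>.\<close>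

definition mat_positive :: "nat \<Rightarrow> 'a::unital_cstar_algebra matrix \<Rightarrow> bool" where
  "mat_positive n a \<longleftrightarrow> (\<exists>b. \<forall>i<n. \<forall>j<n. a i j = (\<Sum>k<n. star (b k i) * b k j))"

text \<open>\<open>n \<times> n\<close> matrices over \<open>B(H)\<close> are ordered as operators on the direct sum of \<open>n\<close>
  copies of \<open>H\<close>, whose inner product is \<open>\<Sum>i<n. cinner (h i) (h' i)\<close>.\<close>

definition opmat_apply :: "nat \<Rightarrow> ('h::chilbert_space, 'k::chilbert_space) cblinfun matrix \<Rightarrow>
    (nat \<Rightarrow> 'h) \<Rightarrow> (nat \<Rightarrow> 'k)" where
  "opmat_apply n A h = (\<lambda>i. \<Sum>j<n. A i j *\<^sub>V h j)"

definition opmat_positive :: "nat \<Rightarrow> ('h::chilbert_space, 'h) cblinfun matrix \<Rightarrow> bool" where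
  "opmat_positive n A \<longleftrightarrow> (\<forall>h. 0 \<le> (\<Sum>i<n. cinner (h i) (opmat_apply n A h i)))"

definition opmat_le :: "nat \<Rightarrow> ('h::chilbert_space, 'h) cblinfun matrix \<Rightarrow>
    ('h, 'h) cblinfun matrix \<Rightarrow> bool" where
  "opmat_le n A B \<longleftrightarrow> opmat_positive n (\<lambda>i j. B i j - A i j)"

definition opmat_adj :: "('h::chilbert_space, 'k::chilbert_space) cblinfun matrix \<Rightarrow>
    ('k, 'h) cblinfun matrix" where
  "opmat_adj A = (\<lambda>i j. cadj (A j i))"

definition opmat_mult :: "nat \<Rightarrow> ('k::chilbert_space, 'l::chilbert_space) cblinfun matrix \<Rightarrow>
    ('h::chilbert_space, 'k) cblinfun matrix \<Rightarrow> ('h, 'l) cblinfun matrix" where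
  "opmat_mult n A B = (\<lambda>i j. \<Sum>k<n. A i k \<circ>\<^sub>C B k j)"

definition completely_positive ::
  "('a::unital_cstar_algebra \<Rightarrow> ('h::chilbert_space, 'h) cblinfun) \<Rightarrow> bool" where
  "completely_positive \<phi> \<longleftrightarrow> clinear \<phi> \<and>
     (\<forall>n a. mat_positive n a \<longrightarrow> opmat_positive n (amplify \<phi> a))"

locale hilbert_module =
  fixes ip :: "'e::cbanach \<Rightarrow> 'e \<Rightarrow> 'a::unital_cstar_algebra"
    and act :: "'e \<Rightarrow> 'a \<Rightarrow> 'e"
  assumes act_add_left: "act (x + y) a = act x a + act y a"
    and act_add_right: "act x (a + b) = act x a + act x b"
    and act_mult: "act x (a * b) = act (act x a) b"
    and act_one: "act x 1 = x"
    and act_scaleC_left: "act (c *\<^sub>C x) a = c *\<^sub>C act x a"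
    and act_scaleC_right: "act x (c *\<^sub>C a) = c *\<^sub>C act x a"
    and ip_add_right: "ip x (y + z) = ip x y + ip x z"
    and ip_scaleC_right: "ip x (c *\<^sub>C y) = c *\<^sub>C ip x y"
    and ip_act_right: "ip x (act y a) = ip x y * a"
    and ip_star: "star (ip x y) = ip y x"
    and ip_positive: "\<exists>b. ip x x = star b * b"
    and ip_definite: "ip x x = 0 \<Longrightarrow> x = 0"
    and norm_ip: "norm x = sqrt (norm (ip x x))"

definition mat_ip :: "('e \<Rightarrow> 'e \<Rightarrow> 'a::unital_cstar_algebra) \<Rightarrow> nat \<Rightarrow>
    'e matrix \<Rightarrow> 'e matrix \<Rightarrow> 'a matrix" where
  "mat_ip ip n x y = (\<lambda>i j. \<Sum>k<n. ip (x k i) (y k j))"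

definition completely_semi_map :: "('e::cbanach \<Rightarrow> 'e \<Rightarrow> 'a::unital_cstar_algebra) \<Rightarrow>
    ('a \<Rightarrow> ('h1::chilbert_space, 'h1) cblinfun) \<Rightarrow>
    ('e \<Rightarrow> ('h1, 'h2::chilbert_space) cblinfun) \<Rightarrow> bool" where
  "completely_semi_map ip \<phi> \<Phi> \<longleftrightarrow> clinear \<Phi> \<and>
     (\<forall>n x. opmat_le n (opmat_mult n (opmat_adj (amplify \<Phi> x)) (amplify \<Phi> x))
                       (amplify \<phi> (mat_ip ip n x x)))"

text \<open>Rank-one operators are bounded by the Cauchy--Schwarz inequality for Hilbert modules.\<close>

definition rank_one :: "('e::cbanach \<Rightarrow> 'e \<Rightarrow> 'a::unital_cstar_algebra) \<Rightarrow> ('e \<Rightarrow> 'a \<Rightarrow> 'e) \<Rightarrow>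
    'e \<Rightarrow> 'e \<Rightarrow> ('e, 'e) cblinfun" where
  "rank_one ip act x y = CBlinfun (\<lambda>z. act x (ip y z))"

definition compact_ops :: "('e::cbanach \<Rightarrow> 'e \<Rightarrow> 'a::unital_cstar_algebra) \<Rightarrow>
    ('e \<Rightarrow> 'a \<Rightarrow> 'e) \<Rightarrow> ('e, 'e) cblinfun set" where
  "compact_ops ip act = closure (cspan {rank_one ip act x y | x y. True})"

definition compact_ops1 :: "('e::cbanach \<Rightarrow> 'e \<Rightarrow> 'a::unital_cstar_algebra) \<Rightarrow>
    ('e \<Rightarrow> 'a \<Rightarrow> 'e) \<Rightarrow> ('e, 'e) cblinfun set" where
  "compact_ops1 ip act = {k + c *\<^sub>C cid | k c. k \<in> compact_ops ip act}"

definition module_adj :: "('e::cbanach \<Rightarrow> 'e \<Rightarrow> 'a::unital_cstar_algebra) \<Rightarrow>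
    ('e, 'e) cblinfun \<Rightarrow> ('e, 'e) cblinfun" where
  "module_adj ip u = (THE v. \<forall>x y. ip (u *\<^sub>V x) y = ip x (v *\<^sub>V y))"

record 's star_algebra =
  sa_carrier :: "'s set"
  sa_add :: "'s \<Rightarrow> 's \<Rightarrow> 's"
  sa_scale :: "complex \<Rightarrow> 's \<Rightarrow> 's"
  sa_mult :: "'s \<Rightarrow> 's \<Rightarrow> 's"
  sa_star :: "'s \<Rightarrow> 's"

definition star_rep :: "'s star_algebra \<Rightarrow> ('s \<Rightarrow> ('k::chilbert_space, 'k) cblinfun) \<Rightarrow> bool" where
  "star_rep X R \<longleftrightarrow>
     (\<forall>s\<in>sa_carrier X. \<forall>t\<in>sa_carrier X. R (sa_add X s t) = R s + R t) \<and>
     (\<forall>c. \<forall>s\<in>sa_carrier X. R (sa_scale X c s) = c *\<^sub>C R s) \<and>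
     (\<forall>s\<in>sa_carrier X. \<forall>t\<in>sa_carrier X. R (sa_mult X s t) = R s \<circ>\<^sub>C R t) \<and>
     (\<forall>s\<in>sa_carrier X. R (sa_star X s) = cadj (R s))"

definition unitarily_equivalent :: "'s star_algebra \<Rightarrow>
    ('s \<Rightarrow> ('k::chilbert_space, 'k) cblinfun) \<Rightarrow> ('s \<Rightarrow> ('l::chilbert_space, 'l) cblinfun) \<Rightarrow> bool" where
  "unitarily_equivalent X R R' \<longleftrightarrow> star_rep X R \<and> star_rep X R' \<and>
     (\<exists>T. cunitary T \<and> (\<forall>s\<in>sa_carrier X. T \<circ>\<^sub>C R s \<circ>\<^sub>C cadj T = R' s))"

definition cstar_sa :: "'a::unital_cstar_algebra star_algebra" where
  "cstar_sa = \<lparr>sa_carrier = UNIV, sa_add = (+), sa_scale = scaleC, sa_mult = (*), sa_star = star\<rparr>"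

definition compact1_sa :: "('e::cbanach \<Rightarrow> 'e \<Rightarrow> 'a::unital_cstar_algebra) \<Rightarrow>
    ('e \<Rightarrow> 'a \<Rightarrow> 'e) \<Rightarrow> ('e, 'e) cblinfun star_algebra" where
  "compact1_sa ip act = \<lparr>sa_carrier = compact_ops1 ip act, sa_add = (+), sa_scale = scaleC,
     sa_mult = (\<circ>\<^sub>C), sa_star = module_adj ip\<rparr>"

text \<open>A quadruple \<open>(u, x, y, a)\<close> stands for the matrix \<open>[u, x; y\<^sup>*, a]\<close>, where \<open>y\<^sup>*\<close> is the map
  \<open>z \<mapsto> ip y z\<close>, and the operations are those of matrices; thus
  \<open>c y\<^sup>* = (cnj c y)\<^sup>*\<close>, \<open>y\<^sup>* u = (u\<^sup>* y)\<^sup>*\<close> and \<open>a y\<^sup>* = (y a\<^sup>*)\<^sup>*\<close>.\<close>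

type_synonym ('e, 'a) linking = "('e, 'e) cblinfun \<times> 'e \<times> 'e \<times> 'a"

definition linking_sa :: "('e::cbanach \<Rightarrow> 'e \<Rightarrow> 'a::unital_cstar_algebra) \<Rightarrow>
    ('e \<Rightarrow> 'a \<Rightarrow> 'e) \<Rightarrow> ('e, 'a) linking star_algebra" where
  "linking_sa ip act =
     \<lparr>sa_carrier = {(u, x, y, a) | u x y a. u \<in> compact_ops1 ip act},
      sa_add = (\<lambda>(u, x, y, a) (u', x', y', a'). (u + u', x + x', y + y', a + a')),
      sa_scale = (\<lambda>c (u, x, y, a). (c *\<^sub>C u, c *\<^sub>C x, cnj c *\<^sub>C y, c *\<^sub>C a)),
      sa_mult = (\<lambda>(u, x, y, a) (u', x', y', a').
        (u \<circ>\<^sub>C u' + rank_one ip act x y',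
         u *\<^sub>V x' + act x a',
         module_adj ip u' *\<^sub>V y + act y' (star a),
         ip y x' + a * a')),
      sa_star = (\<lambda>(u, x, y, a). (module_adj ip u, y, x, star a))\<rparr>"

definition block_rep :: "(('e::cbanach, 'e) cblinfun \<Rightarrow> ('k2::chilbert_space, 'k2) cblinfun) \<Rightarrow>
    ('e \<Rightarrow> ('k1::chilbert_space, 'k2) cblinfun) \<Rightarrow>
    ('a::unital_cstar_algebra \<Rightarrow> ('k1, 'k1) cblinfun) \<Rightarrow>
    ('e, 'a) linking \<Rightarrow> ('k2 \<times> 'k1, 'k2 \<times> 'k1) cblinfun" where
  "block_rep \<sigma> \<Psi> \<rho> = (\<lambda>(u, x, y, a). block (\<sigma> u) (\<Psi> x) (cadj (\<Psi> y)) (\<rho> a))"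

definition induced_rep :: "('e::cbanach \<Rightarrow> 'e \<Rightarrow> 'a::unital_cstar_algebra) \<Rightarrow> ('e \<Rightarrow> 'a \<Rightarrow> 'e) \<Rightarrow>
    ('e \<Rightarrow> ('k1::chilbert_space, 'k2::chilbert_space) cblinfun) \<Rightarrow>
    (('e, 'e) cblinfun \<Rightarrow> ('k2, 'k2) cblinfun) \<Rightarrow> bool" where
  "induced_rep ip act \<Psi> \<sigma> \<longleftrightarrow> star_rep (compact1_sa ip act) \<sigma> \<and>
     (\<forall>x y. \<sigma> (rank_one ip act x y) = \<Psi> x \<circ>\<^sub>C cadj (\<Psi> y))"

text \<open>Uniqueness is as a function on \<open>compact_ops1 ip act\<close>.\<close>

definition unique_induced_rep :: "('e::cbanach \<Rightarrow> 'e \<Rightarrow> 'a::unital_cstar_algebra) \<Rightarrow>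
    ('e \<Rightarrow> 'a \<Rightarrow> 'e) \<Rightarrow>
    ('e \<Rightarrow> ('k1::chilbert_space, 'k2::chilbert_space) cblinfun) \<Rightarrow>
    (('e, 'e) cblinfun \<Rightarrow> ('k2, 'k2) cblinfun) \<Rightarrow> bool" where
  "unique_induced_rep ip act \<Psi> \<sigma> \<longleftrightarrow> induced_rep ip act \<Psi> \<sigma> \<and>
     (\<forall>\<sigma>'. induced_rep ip act \<Psi> \<sigma>' \<longrightarrow> (\<forall>u\<in>compact_ops1 ip act. \<sigma>' u = \<sigma> u))"

definition rho_map :: "('e::cbanach \<Rightarrow> 'e \<Rightarrow> 'a::unital_cstar_algebra) \<Rightarrow>
    ('a \<Rightarrow> ('k1::chilbert_space, 'k1) cblinfun) \<Rightarrow>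
    ('e \<Rightarrow> ('k1, 'k2::chilbert_space) cblinfun) \<Rightarrow> bool" where
  "rho_map ip \<rho> \<Psi> \<longleftrightarrow> clinear \<Psi> \<and> (\<forall>x y. cadj (\<Psi> x) \<circ>\<^sub>C \<Psi> y = \<rho> (ip x y))"

definition dilation_pair :: "('e::cbanach \<Rightarrow> 'e \<Rightarrow> 'a::unital_cstar_algebra) \<Rightarrow>
    ('a \<Rightarrow> ('h1::chilbert_space, 'h1) cblinfun) \<Rightarrow>
    ('e \<Rightarrow> ('h1, 'h2::chilbert_space) cblinfun) \<Rightarrow>
    ('a \<Rightarrow> ('k1::chilbert_space, 'k1) cblinfun) \<Rightarrow> ('h1, 'k1) cblinfun \<Rightarrow>
    ('e \<Rightarrow> ('k1, 'k2::chilbert_space) cblinfun) \<Rightarrow> ('h2, 'k2) cblinfun \<Rightarrow> bool" where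
  "dilation_pair ip \<phi> \<Phi> \<rho> V \<Psi> W \<longleftrightarrow>
     star_rep cstar_sa \<rho> \<and> \<rho> 1 = cid \<and> rho_map ip \<rho> \<Psi> \<and>
     (\<forall>x. \<Phi> x = cadj W \<circ>\<^sub>C \<Psi> x \<circ>\<^sub>C V) \<and>
     (\<forall>a. \<phi> a = cadj V \<circ>\<^sub>C \<rho> a \<circ>\<^sub>C V)"

definition minimal_dilation_pair :: "('e::cbanach \<Rightarrow> 'e \<Rightarrow> 'a::unital_cstar_algebra) \<Rightarrow>
    ('a \<Rightarrow> ('h1::chilbert_space, 'h1) cblinfun) \<Rightarrow>
    ('e \<Rightarrow> ('h1, 'h2::chilbert_space) cblinfun) \<Rightarrow>
    ('a \<Rightarrow> ('k1::chilbert_space, 'k1) cblinfun) \<Rightarrow> ('h1, 'k1) cblinfun \<Rightarrow>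
    ('e \<Rightarrow> ('k1, 'k2::chilbert_space) cblinfun) \<Rightarrow> ('h2, 'k2) cblinfun \<Rightarrow> bool" where
  "minimal_dilation_pair ip \<phi> \<Phi> \<rho> V \<Psi> W \<longleftrightarrow>
     dilation_pair ip \<phi> \<Phi> \<rho> V \<Psi> W \<and>
     closure (cspan {\<rho> a *\<^sub>V V *\<^sub>V h | a h. True}) = UNIV \<and>
     closure (cspan {\<Psi> x *\<^sub>V k | x k. True}) = UNIV"

end

theory Submission
  imports Defs
begin

text \<open>
  A minimal dilation pair is determined by inner products that involve only \<open>\<phi>\<close>, \<open>\<Phi>\<close> and
  the module. The vectors \<open>\<rho> a (V h)\<close> are total in the first dilation space, and their Gram
  matrix depends only on \<open>\<phi>\<close>; matching them with \<open>\<pi> a (U h)\<close> gives the unitary operator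
  \<open>T1\<close> (\<open>Stinespring_unique\<close>). The vectors \<open>\<Psi> x k\<close> are total in the second space,
  and their inner products are \<open>\<langle>k, \<rho> (ip x y) l\<rangle>\<close>, which \<open>T1\<close> carries to the
  corresponding ones for \<open>\<Gamma>\<close>; this gives \<open>T2\<close> (\<open>unitary_between_rho_maps\<close>). The identity
  \<open>T2 W = S\<close> is tested against the vectors \<open>\<Psi> x (\<rho> a (V h)) = \<Psi> (x a) (V h)\<close>, where it is
  the equality of the two factorisations of \<open>\<Phi> (x a)\<close>.

  The representation \<open>\<sigma>\<close> of the unitised compact operators must satisfy
  \<open>\<sigma> u (\<Psi> x k) = \<Psi> (u x) k\<close>, and this formula defines it for every adjointable \<open>u\<close>. The
  operators in question are adjointable, because the adjointable ones form a closed subspace that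
  contains the rank-one operators and the identity. The point that needs work is that the formula
  defines a bounded operator. Put \<open>h = u\<^sup>* u\<close>, fix finitely many \<open>x\<^sub>i\<close> and \<open>k\<^sub>i\<close>, and let
  \<open>a m\<close> be the norm of \<open>\<Sum>\<^sub>i \<Psi> (h\<^sup>m x\<^sub>i) k\<^sub>i\<close>. Since \<open>h\<close> can be moved across the inner
  product, \<open>(a m)\<^sup>2 \<le> a 0 * a (2 m)\<close>, while \<open>a m\<close> grows at most geometrically because
  \<open>\<rho>\<close>, and hence \<open>\<Psi>\<close>, is contractive; iteration along the powers of two bounds \<open>a 1\<close> by a
  constant multiple of \<open>a 0\<close> (\<open>subquadratic_growth\<close>, \<open>comb_bounded\<close>). Neither
  functional calculus nor the order of the C*-algebra enters. The intertwining of \<open>\<sigma>\<close> and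
  \<open>\<tau>\<close> by \<open>T2\<close> is read off on the vectors \<open>\<Psi> x k\<close>, and the linking algebra is treated
  entry by entry.
\<close>

section \<open>Hilbert spaces and adjoints\<close>

lemma cinner_add_left: "cinner (x + y) z = cinner x z + cinner y z"
  by (subst (1 2 3) cinner_commute) (simp add: cinner_add_right)

lemma cinner_scaleC_left: "cinner (c *\<^sub>C x) y = cnj c * cinner x y"
  by (subst (1 2) cinner_commute) (simp add: cinner_scaleC_right)

lemma cinner_zero_right [simp]: "cinner x 0 = 0"
  using cinner_add_right[of x 0 0] by simp

lemma cinner_zero_left [simp]: "cinner 0 x = 0"
  using cinner_add_left[of 0 0 x] by simp

lemma cinner_minus_right: "cinner x (- y) = - cinner x y"
  using cinner_add_right[of x y "- y"] by (simp add: eq_neg_iff_add_eq_0 add.commute)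

lemma cinner_minus_left: "cinner (- x) y = - cinner x y"
  using cinner_add_left[of x "- x" y] by (simp add: eq_neg_iff_add_eq_0 add.commute)

lemma cinner_diff_right: "cinner x (y - z) = cinner x y - cinner x z"
  using cinner_add_right[of x y "- z"] by (simp add: cinner_minus_right)

lemma cinner_diff_left: "cinner (x - y) z = cinner x z - cinner y z"
  using cinner_add_left[of x "- y" z] by (simp add: cinner_minus_left)

lemma cinner_self: "cinner x x = complex_of_real ((norm x)\<^sup>2)"
  by (simp add: norm_eq_sqrt_cinner cmod_cinner_self)

lemma cinner_self_eq_0_iff: "cinner x x = 0 \<longleftrightarrow> x = 0"
  by (simp add: cinner_self)

lemma Re_cinner_commute: "Re (cinner x y) = Re (cinner y x)"
  by (subst cinner_commute) simp

lemma norm_diff_sq: "(norm (x - y))\<^sup>2 = (norm x)\<^sup>2 - 2 * Re (cinner x y) + (norm y)\<^sup>2"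
proof -
  have "complex_of_real ((norm (x - y))\<^sup>2) = cinner (x - y) (x - y)"
    by (rule cinner_self[symmetric])
  also have "\<dots> = cinner x x - cinner x y - cinner y x + cinner y y"
    by (simp add: cinner_diff_left cinner_diff_right)
  finally have "(norm (x - y))\<^sup>2 = Re (cinner x x - cinner x y - cinner y x + cinner y y)"
    by (metis Re_complex_of_real)
  then show ?thesis
    using Re_cinner_commute[of y x] cinner_self[of x] cinner_self[of y]
    by (simp del: of_real_power)
qed

lemma norm_add_sq: "(norm (x + y))\<^sup>2 = (norm x)\<^sup>2 + 2 * Re (cinner x y) + (norm y)\<^sup>2"
  using norm_diff_sq[of x "- y"] by (simp add: cinner_minus_right)

lemma cinner_Cauchy_Schwarz: "cmod (cinner x y) \<le> norm x * norm y"
proof (cases "y = 0")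
  case False
  define N where "N = (norm y)\<^sup>2"
  define c where "c = cinner y x"
  have N: "N > 0" using False by (simp add: N_def)
  have xy: "cinner x y = cnj c" unfolding c_def by (rule cinner_commute)
  have "0 \<le> (norm (complex_of_real N *\<^sub>C x - c *\<^sub>C y))\<^sup>2" by simp
  also have "\<dots> = (N * norm x)\<^sup>2 - 2 * (N * (cmod c)\<^sup>2) + (cmod c * norm y)\<^sup>2"
    using N
    by (simp add: norm_diff_sq norm_scaleC cinner_scaleC_left cinner_scaleC_right xy
        complex_mult_cnj cmod_power2 power2_eq_square[of "Re c"] power2_eq_square[of "Im c"]
        algebra_simps)
  also have "\<dots> = N * (N * (norm x)\<^sup>2 - (cmod c)\<^sup>2)"
    by (simp add: N_def power2_eq_square algebra_simps)
  finally have "(cmod c)\<^sup>2 \<le> N * (norm x)\<^sup>2"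
    using N by (simp add: zero_le_mult_iff)
  then have "(cmod c)\<^sup>2 \<le> (norm x * norm y)\<^sup>2"
    by (simp add: N_def power_mult_distrib mult.commute)
  then have "cmod c \<le> norm x * norm y"
    by (rule power2_le_imp_le) simp
  then show ?thesis by (simp add: xy)
qed simp

lemma cinner_scaleR_right: "cinner x (r *\<^sub>R y) = r *\<^sub>R cinner x y"
  by (simp add: scaleR_scaleC cinner_scaleC_right scaleR_conv_of_real)

lemma bounded_linear_cinner_right: "bounded_linear (cinner x)"
  by (rule bounded_linear_intro[of _ "norm x"])
    (simp_all add: cinner_add_right cinner_scaleR_right
      cinner_Cauchy_Schwarz[of x, unfolded mult.commute[of "norm x"]])

lemma cinner_eqI: "(\<And>z. cinner z x = cinner z y) \<Longrightarrow> x = y"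
  using cinner_self_eq_0_iff[of "x - y"] by (simp add: cinner_diff_right)

lemma parallelogram_mid:
  fixes x y :: "'a::complex_inner"
  shows "(norm (x - y))\<^sup>2 = 2 * (norm x)\<^sup>2 + 2 * (norm y)\<^sup>2 - 4 * (norm ((1/2) *\<^sub>R (x + y)))\<^sup>2"
proof -
  have "4 * (norm ((1/2) *\<^sub>R (x + y)))\<^sup>2 = (norm (x + y))\<^sup>2"
    by (simp add: power_divide del: scaleR_add_right)
  then show ?thesis using norm_diff_sq[of x y] norm_add_sq[of x y] by linarith
qed

text \<open>The Riesz representation theorem: the representing vector is the minimiser of
  \<open>(norm x)\<^sup>2 - 2 * Re (f x)\<close>, and minimising sequences converge by the parallelogram law.\<close>

lemma Riesz_representation:
  fixes f :: "'a::chilbert_space \<Rightarrow> complex"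
  assumes bl: "bounded_linear f" and sc: "\<And>c x. f (c *\<^sub>C x) = c * f x"
  shows "\<exists>z. \<forall>x. f x = cinner z x"
proof -
  interpret f: bounded_linear f by (rule bl)
  obtain B where B: "\<And>x. cmod (f x) \<le> norm x * B" using f.bounded by blast
  define J where "J x = (norm x)\<^sup>2 - 2 * Re (f x)" for x
  have J_lower: "- B\<^sup>2 \<le> J x" for x
  proof -
    have "Re (f x) \<le> norm x * B" using B[of x] complex_Re_le_cmod[of "f x"] by linarith
    moreover have "0 \<le> (norm x - B)\<^sup>2" by simp
    ultimately show ?thesis by (simp add: J_def power2_diff)
  qed
  define m where "m = (INF x. J x)"
  have bdd: "bdd_below (range J)" by (rule bdd_belowI[of _ "- B\<^sup>2"]) (use J_lower in auto)
  have m_le: "m \<le> J x" for x unfolding m_def by (rule cINF_lower[OF bdd]) simp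
  have "\<exists>x. J x < m + 1 / real (Suc n)" for n
    using cINF_less_iff[of UNIV J "m + 1 / real (Suc n)"] bdd by (auto simp: m_def)
  then obtain X where X: "\<And>n. J (X n) < m + 1 / real (Suc n)" by metis
  have close: "(norm (X i - X j))\<^sup>2 \<le> 2 / real (Suc i) + 2 / real (Suc j)" for i j
  proof -
    have "(norm (X i - X j))\<^sup>2 = 2 * J (X i) + 2 * J (X j) - 4 * J ((1/2) *\<^sub>R (X i + X j))"
      unfolding parallelogram_mid[of "X i" "X j"]
      by (simp only: J_def f.scaleR f.add) (simp add: algebra_simps)
    moreover have "2 * J (X i) \<le> 2 * m + 2 / real (Suc i)" "2 * J (X j) \<le> 2 * m + 2 / real (Suc j)"
      using X[of i] X[of j] by simp_all
    ultimately show ?thesis using m_le[of "(1/2) *\<^sub>R (X i + X j)"] by linarith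
  qed
  have "Cauchy X"
  proof (rule CauchyI)
    fix e :: real assume e: "0 < e"
    obtain N where N: "4 / e\<^sup>2 < real (Suc N)"
      using reals_Archimedean2[of "4 / e\<^sup>2"] by (metis less_trans of_nat_less_iff lessI)
    have "norm (X i - X j) < e" if "i \<ge> N" "j \<ge> N" for i j
    proof -
      have "2 / real (Suc i) \<le> 2 / real (Suc N)" "2 / real (Suc j) \<le> 2 / real (Suc N)"
        using that by (auto intro!: divide_left_mono)
      then have "(norm (X i - X j))\<^sup>2 \<le> 4 / real (Suc N)" using close[of i j] by simp
      also have "\<dots> < e\<^sup>2" using N e by (simp add: field_simps)
      finally show ?thesis using e by (simp add: power2_less_imp_less)
    qed
    then show "\<exists>M. \<forall>i\<ge>M. \<forall>j\<ge>M. norm (X i - X j) < e" by blast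
  qed
  then obtain z where z: "X \<longlonglongrightarrow> z" using Cauchy_convergent convergent_def by blast
  have "(\<lambda>n. J (X n)) \<longlonglongrightarrow> J z"
    unfolding J_def by (intro tendsto_intros z f.tendsto)
  moreover have "(\<lambda>n. m + 1 / real (Suc n)) \<longlonglongrightarrow> m"
    using tendsto_add[OF tendsto_const lim_1_over_n[THEN LIMSEQ_Suc], of m] by simp
  ultimately have Jz: "J z \<le> m"
    by (rule LIMSEQ_le) (use X in \<open>auto intro: less_imp_le\<close>)
  have re: "Re (f w) = Re (cinner z w)" for w
  proof -
    define d where "d = Re (cinner z w) - Re (f w)"
    have q: "0 \<le> 2 * t * d + t\<^sup>2 * (norm w)\<^sup>2" for t
    proof -
      have "0 \<le> J (z + t *\<^sub>R w) - J z" using Jz m_le[of "z + t *\<^sub>R w"] by linarith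
      then show ?thesis
        by (simp add: J_def norm_add_sq f.add f.scaleR d_def cinner_scaleR_right
            power_mult_distrib algebra_simps)
    qed
    have "d = 0"
    proof (rule ccontr)
      assume d: "d \<noteq> 0"
      define N where "N = (norm w)\<^sup>2 + 1"
      have N: "N > 0" unfolding N_def by (simp add: add_nonneg_pos)
      \<comment> \<open>\<open>t = - d / N\<close> minimises \<open>2 * t * d + t\<^sup>2 * N\<close>, with a negative value.\<close>
      have "0 \<le> 2 * (- d / N) * d + (- d / N)\<^sup>2 * (norm w)\<^sup>2" by (rule q)
      also have "\<dots> \<le> 2 * (- d / N) * d + (- d / N)\<^sup>2 * N"
        by (simp add: N_def mult_left_mono)
      also have "\<dots> = - (d\<^sup>2 / N)" using N by (simp add: power2_eq_square field_simps)
      finally show False using d N by (simp add: divide_le_0_iff)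
    qed
    then show ?thesis by (simp add: d_def)
  qed
  have "f w = cinner z w" for w
  proof (rule complex_eqI)
    show "Re (f w) = Re (cinner z w)" by (rule re)
    show "Im (f w) = Im (cinner z w)"
      using re[of "\<i> *\<^sub>C w"] by (simp add: sc cinner_scaleC_right)
  qed
  then show ?thesis by blast
qed

lemma capply_add_right: "T *\<^sub>V (x + y) = T *\<^sub>V x + T *\<^sub>V y"
  by transfer (simp add: blinfun.add_right)

lemma capply_scaleC_right: "T *\<^sub>V (c *\<^sub>C x) = c *\<^sub>C (T *\<^sub>V x)"
  by transfer simp

lemma capply_zero_right [simp]: "T *\<^sub>V 0 = 0"
  by transfer simp

lemma capply_zero_left [simp]: "0 *\<^sub>V x = 0"
  by transfer simp

lemma capply_diff: "(S - T) *\<^sub>V x = S *\<^sub>V x - T *\<^sub>V x"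
  by transfer (simp add: blinfun.diff_left)

lemma capply_cid [simp]: "cid *\<^sub>V x = x"
  by transfer simp

lemma capply_ccompose [simp]: "(S \<circ>\<^sub>C T) *\<^sub>V x = S *\<^sub>V T *\<^sub>V x"
  by transfer simp

lemma bounded_linear_capply: "bounded_linear (capply T)"
  by transfer (rule blinfun.bounded_linear_right)

lemma clinearI:
  "\<lbrakk>\<And>x y. f (x + y) = f x + f y; \<And>c x. f (c *\<^sub>C x) = c *\<^sub>C f x\<rbrakk> \<Longrightarrow> clinear f"
  unfolding clinear_def
  by unfold_locales
    (simp_all add: scaleC_add_right scaleC_add_left scaleC_scaleC scaleC_one)

lemma clinear_add: "clinear f \<Longrightarrow> f (x + y) = f x + f y"
  and clinear_scaleC: "clinear f \<Longrightarrow> f (c *\<^sub>C x) = c *\<^sub>C f x"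
  unfolding clinear_def Vector_Spaces.linear_def module_hom_def module_hom_axioms_def
  by blast+

lemma CBlinfun_applyI:
  assumes "\<And>x y. f (x + y) = f x + f y" "\<And>c x. f (c *\<^sub>C x) = c *\<^sub>C f x"
    and "\<And>x. norm (f x) \<le> B * norm x"
  shows "CBlinfun f *\<^sub>V x = f x"
  by (rule CBlinfun_apply[OF clinearI bounded_linear_intro[of f B]])
    (simp_all add: assms scaleR_scaleC mult.commute)

lemma le_of_square_le:
  fixes a b :: real
  assumes "a\<^sup>2 \<le> b * a" "0 \<le> a" "0 \<le> b"
  shows "a \<le> b"
  using assms by (cases "a = 0") (auto simp: power2_eq_square)

lemma ex_cadj:
  fixes T :: "('h::chilbert_space, 'k::chilbert_space) cblinfun"
  shows "\<exists>S. \<forall>x y. cinner (T *\<^sub>V x) y = cinner x (S *\<^sub>V y)"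
proof -
  have "\<exists>z. \<forall>x. cinner y (T *\<^sub>V x) = cinner z x" for y
    by (rule Riesz_representation)
      (simp_all add: bounded_linear_compose[OF bounded_linear_cinner_right bounded_linear_capply]
        capply_scaleC_right cinner_scaleC_right)
  then obtain f where f: "\<And>x y. cinner y (T *\<^sub>V x) = cinner (f y) x" by metis
  then have f': "cinner (T *\<^sub>V x) y = cinner x (f y)" for x y
    by (metis cinner_commute)
  have bound: "norm (f y) \<le> norm T * norm y" for y
  proof (rule le_of_square_le)
    have "(norm (f y))\<^sup>2 = cmod (cinner (T *\<^sub>V f y) y)"
      unfolding f' cinner_self by (simp add: norm_power)
    also have "\<dots> \<le> norm (T *\<^sub>V f y) * norm y" by (rule cinner_Cauchy_Schwarz)
    also have "\<dots> \<le> norm T * norm (f y) * norm y"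
      by (simp add: mult_right_mono norm_capply)
    finally show "(norm (f y))\<^sup>2 \<le> norm T * norm y * norm (f y)" by (simp add: mult_ac)
  qed simp_all
  have "CBlinfun f *\<^sub>V y = f y" for y
  proof (rule CBlinfun_applyI)
    show "f (x + y) = f x + f y" for x y
      by (rule cinner_eqI) (simp add: cinner_add_right flip: f')
    show "f (c *\<^sub>C x) = c *\<^sub>C f x" for c x
      by (rule cinner_eqI) (simp add: cinner_scaleC_right flip: f')
  qed (rule bound)
  then show ?thesis using f' by metis
qed

lemma cadjI:
  assumes "\<And>x y. cinner (T *\<^sub>V x) y = cinner x (S *\<^sub>V y)"
  shows "cadj T = S"
  unfolding cadj_def
proof (rule the_equality)
  fix S' assume "\<forall>x y. cinner (T *\<^sub>V x) y = cinner x (S' *\<^sub>V y)"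
  then show "S' = S" by (intro cblinfun_eqI cinner_eqI) (metis assms)
qed (use assms in blast)

lemma cinner_cadj: "cinner (T *\<^sub>V x) y = cinner x (cadj T *\<^sub>V y)"
  using ex_cadj[of T] cadjI by metis

lemma cinner_cadj': "cinner (cadj T *\<^sub>V x) y = cinner x (T *\<^sub>V y)"
  by (metis cinner_cadj cinner_commute)

lemma cadj_cadj [simp]: "cadj (cadj T) = T"
  by (rule cadjI) (rule cinner_cadj')

lemma cadj_ccompose: "cadj (S \<circ>\<^sub>C T) = cadj T \<circ>\<^sub>C cadj S"
  by (rule cadjI) (simp add: cinner_cadj)

lemma cadj_add: "cadj (S + T) = cadj S + cadj T"
  by (rule cadjI) (simp add: capply_add cinner_add_left cinner_add_right cinner_cadj)

lemma cadj_scaleC: "cadj (c *\<^sub>C T) = cnj c *\<^sub>C cadj T"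
  by (rule cadjI) (simp add: capply_scaleC cinner_scaleC_left cinner_scaleC_right cinner_cadj)

lemma cadj_zero [simp]: "cadj 0 = 0"
  by (rule cadjI) simp

lemma norm_cadj_le: "norm (cadj T) \<le> norm T"
proof (rule norm_cblinfun_le)
  fix y
  show "norm (cadj T *\<^sub>V y) \<le> norm T * norm y"
  proof (rule le_of_square_le)
    have "(norm (cadj T *\<^sub>V y))\<^sup>2 = cmod (cinner (T *\<^sub>V cadj T *\<^sub>V y) y)"
      by (subst cinner_cadj) (simp add: cinner_self norm_power)
    also have "\<dots> \<le> norm (T *\<^sub>V cadj T *\<^sub>V y) * norm y" by (rule cinner_Cauchy_Schwarz)
    also have "\<dots> \<le> norm T * norm (cadj T *\<^sub>V y) * norm y"
      by (simp add: mult_right_mono norm_capply)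
    finally show "(norm (cadj T *\<^sub>V y))\<^sup>2 \<le> norm T * norm y * norm (cadj T *\<^sub>V y)"
      by (simp add: mult_ac)
  qed simp_all
qed simp

lemma cadj_ccompose_eq_0: "T \<circ>\<^sub>C cadj T = 0 \<Longrightarrow> T = 0"
proof -
  assume "T \<circ>\<^sub>C cadj T = 0"
  then have "cinner (cadj T *\<^sub>V y) (cadj T *\<^sub>V y) = 0" for y
    by (metis capply_ccompose capply_zero_left cinner_cadj' cinner_zero_right)
  then have "cadj T = 0" by (intro cblinfun_eqI) (simp add: cinner_self_eq_0_iff)
  then show "T = 0" by (metis cadj_cadj cadj_zero)
qed

lemma cspan_induct [consumes 1, case_names zero step]:
  assumes "x \<in> cspan A" "P 0"
    and "\<And>c x y. x \<in> A \<Longrightarrow> P y \<Longrightarrow> P (c *\<^sub>C x + y)"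
  shows "P x"
  using assms by (rule complex_vector.span_induct_alt)

lemma cblinfun_eq_on_dense:
  assumes dense: "closure (cspan A) = UNIV" and eq: "\<And>x. x \<in> A \<Longrightarrow> S *\<^sub>V x = T *\<^sub>V x"
  shows "S = T"
proof (rule cblinfun_eqI)
  fix x
  have span: "S *\<^sub>V x = T *\<^sub>V x" if "x \<in> cspan A" for x
    using that by (induction rule: cspan_induct) (simp_all add: capply_add_right capply_scaleC_right eq)
  obtain f where f: "\<And>n. f n \<in> cspan A" "f \<longlonglongrightarrow> x"
    using dense by (metis UNIV_I closure_sequential)
  have "(\<lambda>n. S *\<^sub>V f n) \<longlonglongrightarrow> S *\<^sub>V x" "(\<lambda>n. T *\<^sub>V f n) \<longlonglongrightarrow> T *\<^sub>V x"
    using f(2) bounded_linear_capply bounded_linear.tendsto by blast+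
  then show "S *\<^sub>V x = T *\<^sub>V x" using span[OF f(1)] LIMSEQ_unique by auto
qed

lemma cinner_eq_on_dense:
  assumes dense: "closure (cspan A) = UNIV" and eq: "\<And>z. z \<in> A \<Longrightarrow> cinner x z = cinner y z"
  shows "x = y"
proof -
  have span: "cinner x z = cinner y z" if "z \<in> cspan A" for z
    using that by (induction rule: cspan_induct)
      (simp_all add: cinner_add_right cinner_scaleC_right eq)
  obtain f where f: "\<And>n. f n \<in> cspan A" "f \<longlonglongrightarrow> x - y"
    using dense by (metis UNIV_I closure_sequential)
  have "(\<lambda>n. cinner (x - y) (f n)) \<longlonglongrightarrow> cinner (x - y) (x - y)"
    using f(2) bounded_linear_cinner_right bounded_linear.tendsto by blast
  moreover have "cinner (x - y) (f n) = 0" for n by (simp add: cinner_diff_left span[OF f(1)])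
  ultimately have "cinner (x - y) (x - y) = 0" using LIMSEQ_unique[OF _ tendsto_const] by force
  then show ?thesis by (simp add: cinner_self_eq_0_iff)
qed

text \<open>Extension by continuity. The pairs in \<open>R\<close> prescribe values of an operator; the closure
  of their span in the product space is the graph of the extension, which is everywhere
  defined if the first components span a dense subspace.\<close>

lemma bounded_extension:
  fixes R :: "('k::complex_normed_vector \<times> 'l::{complex_normed_vector, complete_space}) set"
  assumes dense: "closure (cspan (fst ` R)) = UNIV"
    and bound: "\<And>x y. (x, y) \<in> cspan R \<Longrightarrow> norm y \<le> C * norm x" and C: "0 \<le> C"
  shows "\<exists>T. (\<forall>(x, y)\<in>R. T *\<^sub>V x = y)"
proof -
  define G where "G = closure (cspan R)"
  have G_seq: "z \<in> G \<longleftrightarrow> (\<exists>f. (\<forall>n. f n \<in> cspan R) \<and> f \<longlonglongrightarrow> z)" for z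
    unfolding G_def by (rule closure_sequential)
  have G_add: "z + w \<in> G" if "z \<in> G" "w \<in> G" for z w
  proof -
    from that obtain f g where "\<forall>n. f n \<in> cspan R" "f \<longlonglongrightarrow> z" "\<forall>n. g n \<in> cspan R" "g \<longlonglongrightarrow> w"
      unfolding G_seq by blast
    then show ?thesis unfolding G_seq
      by (intro exI[of _ "\<lambda>n. f n + g n"]) (auto intro: complex_vector.span_add tendsto_add)
  qed
  have G_scale: "c *\<^sub>C z \<in> G" if "z \<in> G" for c z
  proof -
    from that obtain f where "\<forall>n. f n \<in> cspan R" "f \<longlonglongrightarrow> z" unfolding G_seq by blast
    then show ?thesis unfolding G_seq
      by (intro exI[of _ "\<lambda>n. c *\<^sub>C f n"])
        (auto intro: complex_vector.span_scale bounded_linear.tendsto[OF bounded_linear_scaleC])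
  qed
  have G_bound: "norm y \<le> C * norm x" if G: "(x, y) \<in> G" for x y
  proof -
    from G obtain f where f: "\<And>n. f n \<in> cspan R" "f \<longlonglongrightarrow> (x, y)" unfolding G_seq by blast
    have "(\<lambda>n. norm (snd (f n))) \<longlonglongrightarrow> norm y" "(\<lambda>n. C * norm (fst (f n))) \<longlonglongrightarrow> C * norm x"
      using tendsto_fst[OF f(2)] tendsto_snd[OF f(2)] by (auto intro!: tendsto_intros)
    then show ?thesis by (rule LIMSEQ_le) (use f(1) bound in auto)
  qed
  have G_unique: "y = y'" if "(x, y) \<in> G" "(x, y') \<in> G" for x y y'
  proof -
    have "(x, y) + (- 1) *\<^sub>C (x, y') \<in> G" using that G_add G_scale by blast
    then have "(0, y - y') \<in> G" by (simp add: scaleC_prod_def complex_vector.scale_minus_left scaleC_one)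
    from G_bound[OF this] show ?thesis by simp
  qed
  have fst_span: "\<exists>y. (x, y) \<in> cspan R" if "x \<in> cspan (fst ` R)" for x
    using that
  proof (induction rule: cspan_induct)
    case zero
    then show ?case using complex_vector.span_zero[of R] unfolding zero_prod_def by blast
  next
    case (step c x w)
    then obtain y v where "(x, y) \<in> R" "(w, v) \<in> cspan R" by force
    then have "c *\<^sub>C (x, y) + (w, v) \<in> cspan R"
      by (simp add: complex_vector.span_add complex_vector.span_scale complex_vector.span_base)
    then show ?case by (auto simp: scaleC_prod_def)
  qed
  have "\<exists>y. (x, y) \<in> G" for x
  proof -
    obtain f where f: "\<And>n. f n \<in> cspan (fst ` R)" "f \<longlonglongrightarrow> x"
      using dense by (metis UNIV_I closure_sequential)
    have "\<exists>y. (f n, y) \<in> cspan R" for n using f(1) by (rule fst_span)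
    then obtain g where g: "\<And>n. (f n, g n) \<in> cspan R" by metis
    have diff: "norm (g i - g j) \<le> C * norm (f i - f j)" for i j
      using bound complex_vector.span_diff[OF g[of i] g[of j]] by simp
    have "Cauchy g"
    proof (rule CauchyI)
      fix e :: real assume e: "0 < e"
      have "Cauchy f" using f(2) by (rule LIMSEQ_imp_Cauchy)
      then obtain N where N: "\<And>i j. i \<ge> N \<Longrightarrow> j \<ge> N \<Longrightarrow> norm (f i - f j) < e / (C + 1)"
        using CauchyD[of f "e / (C + 1)"] e C by auto
      have "norm (g i - g j) < e" if "i \<ge> N" "j \<ge> N" for i j
      proof -
        have "norm (g i - g j) \<le> C * norm (f i - f j)" by (rule diff)
        also have "\<dots> \<le> (C + 1) * norm (f i - f j)" by (simp add: mult_right_mono)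
        also have "\<dots> < e" using N[OF that] C by (simp add: field_simps)
        finally show ?thesis .
      qed
      then show "\<exists>M. \<forall>i\<ge>M. \<forall>j\<ge>M. norm (g i - g j) < e" by blast
    qed
    then obtain y where "g \<longlonglongrightarrow> y" using Cauchy_convergent convergent_def by blast
    then have "(\<lambda>n. (f n, g n)) \<longlonglongrightarrow> (x, y)" using f(2) by (rule tendsto_Pair[rotated])
    then show ?thesis unfolding G_seq
      using g by (intro exI[of _ y] exI[of _ "\<lambda>n. (f n, g n)"]) blast
  qed
  then obtain t where t: "\<And>x. (x, t x) \<in> G" by metis
  have "CBlinfun t *\<^sub>V x = t x" for x
  proof (rule CBlinfun_applyI)
    show "t (x + y) = t x + t y" for x y
      using G_unique[OF t] G_add[OF t t, of x y] by simp
    show "t (c *\<^sub>C x) = c *\<^sub>C t x" for c x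
      using G_unique[OF t] G_scale[OF t, of c x] by (simp add: scaleC_prod_def)
    show "norm (t x) \<le> C * norm x" for x
      using G_bound[OF t] .
  qed
  moreover have "t x = y" if "(x, y) \<in> R" for x y
    using G_unique[OF t] that complex_vector.span_base closure_subset unfolding G_def by blast
  ultimately show ?thesis by (intro exI[of _ "CBlinfun t"]) auto
qed

lemma cunitary_if_isometric_dense:
  fixes T :: "('k::chilbert_space, 'l::chilbert_space) cblinfun"
  assumes iso: "cadj T \<circ>\<^sub>C T = cid" and dense: "closure (cspan B) = UNIV" and B: "B \<subseteq> range (capply T)"
  shows "cunitary T"
  unfolding cunitary_def
proof
  show "T \<circ>\<^sub>C cadj T = cid"
  proof (rule cblinfun_eq_on_dense[OF dense])
    fix y assume "y \<in> B"
    then obtain x where y: "y = T *\<^sub>V x" using B by auto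
    have "cadj T *\<^sub>V T *\<^sub>V x = x" using iso by (metis capply_ccompose capply_cid)
    then show "(T \<circ>\<^sub>C cadj T) *\<^sub>V y = cid *\<^sub>V y" by (simp add: y)
  qed
qed (rule iso)

text \<open>Two total families with equal Gram matrices are related by a unitary operator.\<close>

lemma unitary_of_equal_Gram:
  fixes p :: "'i \<Rightarrow> 'k::chilbert_space" and q :: "'i \<Rightarrow> 'l::chilbert_space"
  assumes Gram: "\<And>i j. cinner (p i) (p j) = cinner (q i) (q j)"
    and p: "closure (cspan (range p)) = UNIV" and q: "closure (cspan (range q)) = UNIV"
  shows "\<exists>T. cunitary T \<and> (\<forall>i. T *\<^sub>V p i = q i)"
proof -
  define R where "R = range (\<lambda>i. (p i, q i))"
  have one: "cinner (p i) (fst w) = cinner (q i) (snd w)" if "w \<in> cspan R" for w i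
    using that by (induction rule: cspan_induct)
      (auto simp: cinner_add_right cinner_scaleC_right scaleC_prod_def R_def Gram)
  have "cinner (fst z) (fst w) = cinner (snd z) (snd w)" if "z \<in> cspan R" "w \<in> cspan R" for z w
    using that by (induction rule: cspan_induct)
      (auto simp: cinner_add_left cinner_scaleC_left scaleC_prod_def R_def one)
  then have "norm y \<le> 1 * norm x" if "(x, y) \<in> cspan R" for x y
    using that by (force simp: norm_eq_sqrt_cinner)
  moreover have "fst ` R = range p" by (auto simp: R_def image_image)
  ultimately obtain T where "\<forall>(x, y)\<in>R. T *\<^sub>V x = y"
    using bounded_extension[of R 1] p by auto
  then have T: "T *\<^sub>V p i = q i" for i by (auto simp: R_def)
  have "cadj T \<circ>\<^sub>C T = cid"
  proof (rule cblinfun_eq_on_dense[OF p])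
    fix x assume "x \<in> range p"
    then obtain i where x: "x = p i" by auto
    have "cadj T *\<^sub>V T *\<^sub>V p i = p i"
    proof (rule cinner_eq_on_dense[OF p])
      show "cinner (cadj T *\<^sub>V T *\<^sub>V p i) z = cinner (p i) z" if "z \<in> range p" for z
        using that by (auto simp: cinner_cadj' T Gram)
    qed
    then show "(cadj T \<circ>\<^sub>C T) *\<^sub>V x = cid *\<^sub>V x" by (simp add: x)
  qed
  then have "cunitary T" by (rule cunitary_if_isometric_dense[OF _ q]) (auto simp flip: T)
  then show ?thesis using T by blast
qed

section \<open>Unital C*-algebras and their representations\<close>

lemma norm_star [simp]: "norm (star a) = norm (a::'a::unital_cstar_algebra)"
proof -
  have le: "norm b \<le> norm (star b)" for b :: 'a
    by (rule le_of_square_le) (simp_all add: norm_mult_ineq flip: cstar_identity)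
  show ?thesis using le[of a] le[of "star a"] by (simp add: star_star)
qed

instance unital_cstar_algebra \<subseteq> banach ..

text \<open>The Neumann series. As the algebra may be zero, \<open>norm 1\<close> need not be \<open>1\<close>.\<close>

lemma Neumann_left_inverse:
  fixes a :: "'a::unital_cstar_algebra"
  assumes "norm a < 1"
  shows "\<exists>y. y * (1 - a) = 1"
proof -
  have le: "norm (a ^ n) \<le> norm (1::'a) * norm a ^ n" for n
  proof (induction n)
    case (Suc n)
    have "norm (a ^ Suc n) \<le> norm a * norm (a ^ n)" by (simp add: norm_mult_ineq)
    also have "\<dots> \<le> norm a * (norm (1::'a) * norm a ^ n)" by (intro mult_left_mono Suc) simp
    finally show ?case by (simp add: mult_ac)
  qed simp
  have "summable (\<lambda>n. norm (1::'a) * norm a ^ n)"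
    using assms by (intro summable_mult summable_geometric) simp
  then have summ: "summable (\<lambda>n. a ^ n)"
    by (rule summable_comparison_test[rotated]) (use le in blast)
  then have "(\<lambda>n. a ^ n * (1 - a)) sums ((\<Sum>n. a ^ n) * (1 - a))"
    by (intro sums_mult2 summable_sums)
  moreover have "a ^ n * (1 - a) = a ^ n - a ^ Suc n" for n
    by (simp only: right_diff_distrib mult_1_right power_Suc2)
  moreover have "(\<lambda>n. a ^ n - a ^ Suc n) sums (a ^ 0 - 0)"
    by (rule telescope_sums'[OF summable_LIMSEQ_zero[OF summ]])
  ultimately have "(\<Sum>n. a ^ n) * (1 - a) = 1" by (simp add: sums_unique2)
  then show ?thesis by blast
qed

lemma star_rep_cstar:
  assumes "star_rep cstar_sa \<rho>"
  shows "\<rho> (a + b) = \<rho> a + \<rho> b" "\<rho> (c *\<^sub>C a) = c *\<^sub>C \<rho> a" "\<rho> (a * b) = \<rho> a \<circ>\<^sub>C \<rho> b"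
    "\<rho> (star a) = cadj (\<rho> a)"
  using assms by (auto simp: star_rep_def cstar_sa_def)

text \<open>Unital representations are contractive. If \<open>T = \<rho> a\<close> had norm larger than that of
  \<open>a\<close>, then \<open>1 - a\<^sup>* a / (norm T)\<^sup>2\<close> would be invertible by the Neumann series, hence
  \<open>1 - T\<^sup>* T / (norm T)\<^sup>2\<close> would be bounded below, although \<open>T\<close> almost attains its norm.\<close>

lemma norm_star_rep_le:
  fixes \<rho> :: "'a::unital_cstar_algebra \<Rightarrow> ('k::chilbert_space, 'k) cblinfun"
  assumes rep: "star_rep cstar_sa \<rho>" and one: "\<rho> 1 = cid"
  shows "norm (\<rho> a) \<le> norm a"
proof (rule ccontr)
  assume less: "\<not> norm (\<rho> a) \<le> norm a"
  define T where "T = \<rho> a"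
  define M where "M = (norm T)\<^sup>2"
  have T: "norm a < norm T" "norm T > 0" using less norm_ge_zero[of a] by (auto simp: T_def)
  then have M: "M > 0" by (simp add: M_def)
  define s where "s = complex_of_real (- 1 / M) *\<^sub>C (star a * a)"
  have "norm s = (norm a)\<^sup>2 / M"
    using M by (simp add: s_def norm_scaleC cstar_identity norm_divide)
  also have "\<dots> < 1" using T M by (simp add: M_def power_strict_mono)
  finally have "norm (- s) < 1" by simp
  then obtain y where y: "y * (1 + s) = 1" using Neumann_left_inverse[of "- s"] by auto
  define L where "L = norm (\<rho> y) + 1"
  have L: "L > 0" unfolding L_def by (simp add: add_nonneg_pos)
  have low: "(norm (T *\<^sub>V k))\<^sup>2 \<le> M * (1 - 1 / L\<^sup>2) * (norm k)\<^sup>2" for k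
  proof -
    define g where "g = k - (1 / M) *\<^sub>R (cadj T *\<^sub>V T *\<^sub>V k)"
    have "\<rho> (1 + s) *\<^sub>V k = g"
      unfolding s_def star_rep_cstar[OF rep] one g_def T_def
      by (simp add: capply_add capply_diff capply_scaleC scaleR_scaleC
          complex_vector.scale_minus_left)
    moreover have "\<rho> y *\<^sub>V \<rho> (1 + s) *\<^sub>V k = k"
      by (metis y one star_rep_cstar(3)[OF rep] capply_ccompose capply_cid)
    ultimately have "norm k \<le> norm (\<rho> y) * norm g" using norm_capply by metis
    also have "\<dots> \<le> L * norm g" by (simp add: L_def mult_right_mono)
    finally have "(norm k)\<^sup>2 \<le> L\<^sup>2 * (norm g)\<^sup>2"
      using power_mono[of "norm k" "L * norm g" 2] by (simp add: power_mult_distrib)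
    moreover have "(norm g)\<^sup>2 \<le> (norm k)\<^sup>2 - (norm (T *\<^sub>V k))\<^sup>2 / M"
    proof -
      have "norm (cadj T *\<^sub>V T *\<^sub>V k) \<le> norm T * norm (T *\<^sub>V k)"
        using norm_capply[of "cadj T" "T *\<^sub>V k"] norm_cadj_le[of T]
        by (meson mult_right_mono norm_ge_zero order_trans)
      then have "(norm (cadj T *\<^sub>V T *\<^sub>V k))\<^sup>2 \<le> (norm T * norm (T *\<^sub>V k))\<^sup>2"
        by (rule power_mono) simp
      then have adj: "(norm (cadj T *\<^sub>V T *\<^sub>V k))\<^sup>2 \<le> M * (norm (T *\<^sub>V k))\<^sup>2"
        by (simp add: M_def power_mult_distrib)
      have "cinner k (cadj T *\<^sub>V T *\<^sub>V k) = complex_of_real ((norm (T *\<^sub>V k))\<^sup>2)"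
        by (simp add: cinner_self flip: cinner_cadj)
      then have "(norm g)\<^sup>2 = (norm k)\<^sup>2 - 2 * (norm (T *\<^sub>V k))\<^sup>2 / M
          + (norm (cadj T *\<^sub>V T *\<^sub>V k))\<^sup>2 / M\<^sup>2"
        by (simp add: g_def norm_diff_sq cinner_scaleR_right power_divide del: of_real_power)
      also have "\<dots> \<le> (norm k)\<^sup>2 - 2 * (norm (T *\<^sub>V k))\<^sup>2 / M + M * (norm (T *\<^sub>V k))\<^sup>2 / M\<^sup>2"
        using adj by (simp add: divide_right_mono)
      also have "\<dots> = (norm k)\<^sup>2 - (norm (T *\<^sub>V k))\<^sup>2 / M"
        using M by (simp add: power2_eq_square)
      finally show ?thesis .
    qed
    ultimately have "(norm k)\<^sup>2 \<le> L\<^sup>2 * ((norm k)\<^sup>2 - (norm (T *\<^sub>V k))\<^sup>2 / M)"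
      by (meson mult_left_mono order_trans zero_le_power2)
    then show ?thesis using L M by (simp add: field_simps)
  qed
  have "1 \<le> L\<^sup>2" by (rule one_le_power) (simp add: L_def)
  then have "1 / L\<^sup>2 \<le> 1" by (simp add: divide_le_eq)
  then have c: "0 \<le> M * (1 - 1 / L\<^sup>2)" using M by (intro mult_nonneg_nonneg) simp_all
  have "norm T \<le> sqrt (M * (1 - 1 / L\<^sup>2))"
  proof (rule norm_cblinfun_le)
    fix k :: 'k
    have "sqrt ((norm (T *\<^sub>V k))\<^sup>2) \<le> sqrt (M * (1 - 1 / L\<^sup>2) * (norm k)\<^sup>2)"
      using low by (rule real_sqrt_le_mono)
    then show "norm (T *\<^sub>V k) \<le> sqrt (M * (1 - 1 / L\<^sup>2)) * norm k"
      by (simp add: real_sqrt_mult)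
  qed (use c in simp)
  also have "\<dots> < sqrt M" using M L by simp
  also have "\<dots> = norm T" by (simp add: M_def)
  finally show False by simp
qed

section \<open>Adjointable operators on Hilbert modules\<close>

context hilbert_module
begin

lemma ip_add_left: "ip (x + y) z = ip x z + ip y z"
  using arg_cong[OF ip_add_right[of z x y], of star] by (simp add: star_add ip_star)

lemma ip_scaleC_left: "ip (c *\<^sub>C x) y = cnj c *\<^sub>C ip x y"
  using arg_cong[OF ip_scaleC_right[of y c x], of star] by (simp add: star_scaleC ip_star)

lemma ip_act_left: "ip (act x a) y = star a * ip x y"
  using arg_cong[OF ip_act_right[of y x a], of star] by (simp add: star_mult ip_star)

lemma ip_zero_right [simp]: "ip x 0 = 0"
  using ip_add_right[of x 0 0] by simp

lemma ip_zero_left [simp]: "ip 0 x = 0"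
  using ip_add_left[of 0 0 x] by simp

lemma ip_diff_right: "ip x (y - z) = ip x y - ip x z"
  using ip_add_right[of x "y - z" z] by simp

lemma ip_diff_left: "ip (x - y) z = ip x z - ip y z"
  using ip_add_left[of "x - y" y z] by simp

lemma norm_sq_ip: "norm (ip x x) = (norm x)\<^sup>2"
  by (simp add: norm_ip)

lemma ip_eqI: "(\<And>z. ip z x = ip z y) \<Longrightarrow> x = y"
  using ip_definite[of "x - y"] by (simp add: ip_diff_right)

lemma polarisation:
  "4 *\<^sub>C ip x y = ip (x + y) (x + y) - ip (x - y) (x - y)
     - \<i> *\<^sub>C (ip (x + \<i> *\<^sub>C y) (x + \<i> *\<^sub>C y) - ip (x - \<i> *\<^sub>C y) (x - \<i> *\<^sub>C y))"
proof -
  have diff: "ip (x + z) (x + z) - ip (x - z) (x - z) = 2 *\<^sub>C ip x z + 2 *\<^sub>C ip z x" for z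
    using scaleC_add_left[of 1 1 "ip x z"] scaleC_add_left[of 1 1 "ip z x"]
    by (simp add: ip_add_left ip_add_right ip_diff_left ip_diff_right scaleC_one)
  have i: "\<i> * (2 * \<i>) = - 2" by (simp add: complex_eq_iff)
  have "\<i> *\<^sub>C (2 *\<^sub>C ip x (\<i> *\<^sub>C y) + 2 *\<^sub>C ip (\<i> *\<^sub>C y) x) = - (2 *\<^sub>C ip x y) + 2 *\<^sub>C ip y x"
    by (simp add: ip_scaleC_left ip_scaleC_right scaleC_add_right scaleC_scaleC
        complex_vector.scale_minus_left complex_vector.scale_right_diff_distrib i)
  moreover have "4 *\<^sub>C ip x y = 2 *\<^sub>C ip x y + 2 *\<^sub>C ip x y"
    using scaleC_add_left[of 2 2 "ip x y"] by simp
  ultimately show ?thesis unfolding diff by simp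
qed

text \<open>The constant is not optimal, but as the norm of the module is known to satisfy the
  triangle inequality, polarisation gives this estimate without any order on the algebra.\<close>

lemma norm_ip_le: "norm (ip x y) \<le> 4 * norm x * norm y"
proof -
  have crude: "norm (ip x y) \<le> (norm x + norm y)\<^sup>2" for x y
  proof -
    have le: "norm (ip z z) \<le> (norm x + norm y)\<^sup>2" if "norm z \<le> norm x + norm y" for z
      using that by (simp add: norm_sq_ip power_mono)
    have plus: "norm (ip (x + z) (x + z)) \<le> (norm x + norm y)\<^sup>2" if "norm z = norm y" for z
      using norm_triangle_ineq[of x z] that by (intro le) simp
    have minus: "norm (ip (x - z) (x - z)) \<le> (norm x + norm y)\<^sup>2" if "norm z = norm y" for z
      using norm_triangle_ineq4[of x z] that by (intro le) simp
    have iy: "norm (\<i> *\<^sub>C y) = norm y" by (simp add: norm_scaleC)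
    have four: "norm (a - b - \<i> *\<^sub>C (c - d)) \<le> norm a + norm b + norm c + norm d" for a b c d :: 'a
      using norm_triangle_ineq4[of "a - b" "\<i> *\<^sub>C (c - d)"] norm_triangle_ineq4[of a b]
        norm_triangle_ineq4[of c d] by (simp add: norm_scaleC)
    have "4 * norm (ip x y) = norm (4 *\<^sub>C ip x y)" by (simp add: norm_scaleC)
    also have "\<dots> \<le> norm (ip (x + y) (x + y)) + norm (ip (x - y) (x - y))
        + norm (ip (x + \<i> *\<^sub>C y) (x + \<i> *\<^sub>C y)) + norm (ip (x - \<i> *\<^sub>C y) (x - \<i> *\<^sub>C y))"
      unfolding polarisation by (rule four)
    also have "\<dots> \<le> 4 * (norm x + norm y)\<^sup>2"
      using plus[of y] minus[of y] plus[OF iy] minus[OF iy] by simp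
    finally show ?thesis by simp
  qed
  show ?thesis
  proof (cases "x = 0 \<or> y = 0")
    case False
    define u where "u = complex_of_real (1 / norm x) *\<^sub>C x"
    define v where "v = complex_of_real (1 / norm y) *\<^sub>C y"
    have "norm u = 1" "norm v = 1" using False by (simp_all add: u_def v_def norm_scaleC norm_divide)
    then have "norm (ip u v) \<le> 4" using crude[of u v] by simp
    moreover have "norm (ip u v) = norm (ip x y) / (norm x * norm y)"
      by (simp add: u_def v_def ip_scaleC_left ip_scaleC_right norm_scaleC norm_divide norm_mult)
    ultimately show ?thesis using False by (simp add: field_simps)
  qed auto
qed

lemma norm_act_le: "norm (act x a) \<le> norm x * norm a"
proof (rule power2_le_imp_le)
  have "(norm (act x a))\<^sup>2 = norm (star a * (ip x x * a))"
    by (simp add: ip_act_left ip_act_right mult.assoc flip: norm_sq_ip)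
  also have "\<dots> \<le> norm a * (norm (ip x x) * norm a)"
    using norm_mult_ineq[of "star a" "ip x x * a"]
      mult_left_mono[OF norm_mult_ineq[of "ip x x" a] norm_ge_zero[of a]] by simp
  finally show "(norm (act x a))\<^sup>2 \<le> (norm x * norm a)\<^sup>2"
    by (simp add: norm_sq_ip power2_eq_square mult_ac)
qed simp

lemma rank_one_apply: "rank_one ip act x y *\<^sub>V z = act x (ip y z)"
  unfolding rank_one_def
proof (rule CBlinfun_applyI)
  fix z
  have "norm (act x (ip y z)) \<le> norm x * norm (ip y z)" by (rule norm_act_le)
  also have "\<dots> \<le> norm x * (4 * norm y * norm z)" by (intro mult_left_mono norm_ip_le) simp
  finally show "norm (act x (ip y z)) \<le> (norm x * 4 * norm y) * norm z" by (simp add: mult_ac)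
qed (simp_all add: ip_add_right ip_scaleC_right act_add_right act_scaleC_right)

text \<open>The operators that have an adjoint with respect to the algebra-valued inner product.
  Complex-linearity and boundedness of the adjoint are consequences of the defining
  property, so only the pointwise existence of its values is required.\<close>

definition adjointable :: "('e, 'e) cblinfun \<Rightarrow> bool" where
  "adjointable u \<longleftrightarrow> (\<forall>y. \<exists>z. \<forall>x. ip (u *\<^sub>V x) y = ip x z)"

lemma module_adj_eqI:
  assumes "\<And>x y. ip (u *\<^sub>V x) y = ip x (v *\<^sub>V y)"
  shows "module_adj ip u = v"
  unfolding module_adj_def
proof (rule the_equality)
  fix v' assume "\<forall>x y. ip (u *\<^sub>V x) y = ip x (v' *\<^sub>V y)"
  then show "v' = v" by (intro cblinfun_eqI ip_eqI) (metis assms)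
qed (use assms in blast)

lemma ip_module_adj:
  assumes "adjointable u"
  shows "ip (u *\<^sub>V x) y = ip x (module_adj ip u *\<^sub>V y)"
proof -
  from assms obtain f where f: "\<And>x y. ip (u *\<^sub>V x) y = ip x (f y)"
    unfolding adjointable_def by metis
  have "CBlinfun f *\<^sub>V y = f y" for y
  proof (rule CBlinfun_applyI)
    show "f (x + y) = f x + f y" for x y
      by (rule ip_eqI) (simp add: ip_add_right flip: f)
    show "f (c *\<^sub>C x) = c *\<^sub>C f x" for c x
      by (rule ip_eqI) (simp add: ip_scaleC_right flip: f)
    show "norm (f y) \<le> (4 * norm u) * norm y" for y
    proof (rule le_of_square_le)
      have "(norm (f y))\<^sup>2 = norm (ip (u *\<^sub>V f y) y)" by (simp add: f norm_sq_ip)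
      also have "\<dots> \<le> 4 * norm (u *\<^sub>V f y) * norm y" by (rule norm_ip_le)
      also have "\<dots> \<le> 4 * (norm u * norm (f y)) * norm y"
        by (intro mult_right_mono mult_left_mono norm_capply) simp_all
      finally show "(norm (f y))\<^sup>2 \<le> (4 * norm u) * norm y * norm (f y)" by (simp add: mult_ac)
    qed simp_all
  qed
  then show ?thesis using module_adj_eqI[of u "CBlinfun f"] f by metis
qed

lemma ip_module_adj':
  assumes "adjointable u"
  shows "ip (module_adj ip u *\<^sub>V x) y = ip x (u *\<^sub>V y)"
  using arg_cong[OF ip_module_adj[OF assms, of y x], of star] by (simp add: ip_star)

lemma adjointableI: "(\<And>x y. ip (u *\<^sub>V x) y = ip x (v *\<^sub>V y)) \<Longrightarrow> adjointable u"
  unfolding adjointable_def by blast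

lemma adjointable_module_adj: "adjointable u \<Longrightarrow> adjointable (module_adj ip u)"
  by (rule adjointableI) (rule ip_module_adj')

lemma adjointable_zero: "adjointable 0"
  by (rule adjointableI[of _ 0]) simp

lemma adjointable_cid: "adjointable cid"
  by (rule adjointableI[of _ cid]) simp

lemma adjointable_add: "adjointable u \<Longrightarrow> adjointable v \<Longrightarrow> adjointable (u + v)"
  by (rule adjointableI[of _ "module_adj ip u + module_adj ip v"])
    (simp add: capply_add ip_add_left ip_add_right ip_module_adj)

lemma adjointable_scaleC: "adjointable u \<Longrightarrow> adjointable (c *\<^sub>C u)"
  by (rule adjointableI[of _ "cnj c *\<^sub>C module_adj ip u"])
    (simp add: capply_scaleC ip_scaleC_left ip_scaleC_right ip_module_adj)

lemma adjointable_ccompose: "adjointable u \<Longrightarrow> adjointable v \<Longrightarrow> adjointable (u \<circ>\<^sub>C v)"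
  by (rule adjointableI[of _ "module_adj ip v \<circ>\<^sub>C module_adj ip u"]) (simp add: ip_module_adj)

lemma adjointable_rank_one: "adjointable (rank_one ip act x y)"
  by (rule adjointableI[of _ "rank_one ip act y x"])
    (simp add: rank_one_apply ip_act_left ip_act_right ip_star)

lemma adjointable_cspan_rank_one:
  "u \<in> cspan {rank_one ip act x y | x y. True} \<Longrightarrow> adjointable u"
proof (induction rule: cspan_induct)
  case (step c u v)
  then show ?case using adjointable_add adjointable_scaleC adjointable_rank_one by blast
qed (rule adjointable_zero)

lemma adjointable_limit:
  assumes "\<And>n. adjointable (u n)" and lim: "u \<longlonglongrightarrow> v"
  shows "adjointable v"
  unfolding adjointable_def
proof
  fix y
  define z where "z n = module_adj ip (u n) *\<^sub>V y" for n
  have z: "ip (u n *\<^sub>V x) y = ip x (z n)" for n x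
    unfolding z_def by (rule ip_module_adj) (rule assms(1))
  define C where "C = 4 * norm y + 1"
  have C: "C > 0" by (simp add: C_def add_nonneg_pos)
  have close: "norm (z i - z j) \<le> C * norm (u i - u j)" for i j
  proof (rule le_of_square_le)
    have "(norm (z i - z j))\<^sup>2 = norm (ip ((u i - u j) *\<^sub>V (z i - z j)) y)"
      by (simp add: capply_diff ip_diff_left z ip_diff_right flip: norm_sq_ip)
    also have "\<dots> \<le> 4 * norm ((u i - u j) *\<^sub>V (z i - z j)) * norm y" by (rule norm_ip_le)
    also have "\<dots> \<le> 4 * (norm (u i - u j) * norm (z i - z j)) * norm y"
      by (intro mult_right_mono mult_left_mono norm_capply) simp_all
    also have "\<dots> = (4 * norm y) * (norm (u i - u j) * norm (z i - z j))" by simp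
    also have "\<dots> \<le> C * (norm (u i - u j) * norm (z i - z j))"
      by (intro mult_right_mono) (simp_all add: C_def)
    finally show "(norm (z i - z j))\<^sup>2 \<le> C * norm (u i - u j) * norm (z i - z j)"
      by (simp add: mult.assoc)
  qed (use C in simp_all)
  have "Cauchy z"
  proof (rule CauchyI)
    fix e :: real assume e: "0 < e"
    have "Cauchy u" using lim by (rule LIMSEQ_imp_Cauchy)
    then obtain N where N: "\<And>i j. i \<ge> N \<Longrightarrow> j \<ge> N \<Longrightarrow> norm (u i - u j) < e / C"
      using CauchyD[of u "e / C"] e C by auto
    have "norm (z i - z j) < e" if "i \<ge> N" "j \<ge> N" for i j
      using close[of i j] N[OF that] C by (simp add: field_simps)
    then show "\<exists>M. \<forall>i\<ge>M. \<forall>j\<ge>M. norm (z i - z j) < e" by blast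
  qed
  then obtain w where w: "z \<longlonglongrightarrow> w" using Cauchy_convergent convergent_def by blast
  have "ip (v *\<^sub>V x) y = ip x w" for x
  proof -
    have "bounded_linear (ip x)"
      by (rule bounded_linear_intro[of _ "4 * norm x"])
        (simp_all add: ip_add_right scaleR_scaleC ip_scaleC_right
          norm_ip_le[of x, unfolded mult.commute[of "4 * norm x"]])
    then have right: "(\<lambda>n. ip x (z n)) \<longlonglongrightarrow> ip x w" using w bounded_linear.tendsto by blast
    have "bounded_linear (\<lambda>u. ip (u *\<^sub>V x) y)"
    proof (rule bounded_linear_intro[of _ "4 * norm x * norm y"])
      fix u
      have "norm (ip (u *\<^sub>V x) y) \<le> 4 * norm (u *\<^sub>V x) * norm y" by (rule norm_ip_le)
      also have "\<dots> \<le> 4 * (norm u * norm x) * norm y"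
        by (intro mult_right_mono mult_left_mono norm_capply) simp_all
      finally show "norm (ip (u *\<^sub>V x) y) \<le> norm u * (4 * norm x * norm y)" by (simp add: mult_ac)
    qed (simp_all add: capply_add ip_add_left scaleR_scaleC capply_scaleC ip_scaleC_left)
    then have "(\<lambda>n. ip (u n *\<^sub>V x) y) \<longlonglongrightarrow> ip (v *\<^sub>V x) y" using lim bounded_linear.tendsto by blast
    then show ?thesis using right unfolding z by (rule LIMSEQ_unique)
  qed
  then show "\<exists>z. \<forall>x. ip (v *\<^sub>V x) y = ip x z" by blast
qed

lemma adjointable_compact_ops1: "u \<in> compact_ops1 ip act \<Longrightarrow> adjointable u"
proof -
  assume "u \<in> compact_ops1 ip act"
  then obtain k c where u: "u = k + c *\<^sub>C cid" and k: "k \<in> compact_ops ip act"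
    unfolding compact_ops1_def by blast
  from k obtain f where f: "\<And>n. f n \<in> cspan {rank_one ip act x y | x y. True}" "f \<longlonglongrightarrow> k"
    unfolding compact_ops_def closure_sequential by blast
  have "adjointable k"
    by (rule adjointable_limit[OF adjointable_cspan_rank_one f(2)]) (rule f(1))
  then show "adjointable u"
    unfolding u by (intro adjointable_add adjointable_scaleC adjointable_cid)
qed

lemma rank_one_in_compact_ops1: "rank_one ip act x y \<in> compact_ops1 ip act"
proof -
  have "rank_one ip act x y \<in> compact_ops ip act"
    unfolding compact_ops_def
    by (intro subsetD[OF closure_subset] complex_vector.span_base) blast
  moreover have "rank_one ip act x y = rank_one ip act x y + 0 *\<^sub>C cid"
    by (simp add: complex_vector.scale_zero_left)
  ultimately show ?thesis unfolding compact_ops1_def by blast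
qed

end

section \<open>Representations of operators induced by a non-degenerate module map\<close>

text \<open>If \<open>a 1\<close> exceeded \<open>B * a 0\<close> by a factor \<open>r > 1\<close>, iteration of the quadratic inequality
  would give \<open>a (2 ^ n) \<ge> a 0 * (B * r) ^ (2 ^ n)\<close>, which contradicts the geometric bound.\<close>

lemma subquadratic_growth:
  fixes a :: "nat \<Rightarrow> real"
  assumes nonneg: "\<And>m. 0 \<le> a m" and sq: "\<And>m. (a m)\<^sup>2 \<le> a 0 * a (2 * m)"
    and growth: "\<And>m. a m \<le> D * B ^ m" and B: "B > 0"
  shows "a 1 \<le> B * a 0"
proof (cases "a 0 = 0")
  case True
  then show ?thesis using sq[of 1] by simp
next
  case False
  then have a0: "a 0 > 0" using nonneg[of 0] by simp
  show ?thesis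
  proof (rule ccontr)
    define r where "r = a 1 / (B * a 0)"
    assume "\<not> ?thesis"
    then have r: "r > 1" using B a0 by (simp add: r_def)
    have low: "a 0 * (B * r) ^ (2 ^ n) \<le> a (2 ^ n)" for n
    proof (induction n)
      case 0
      then show ?case using B a0 by (simp add: r_def)
    next
      case (Suc n)
      have "(a 0 * (B * r) ^ (2 ^ n))\<^sup>2 \<le> (a (2 ^ n))\<^sup>2"
        using Suc by (rule power_mono) (use a0 B r in simp)
      also have "\<dots> \<le> a 0 * a (2 ^ Suc n)" using sq[of "2 ^ n"] by simp
      finally have "a 0 * (a 0 * (B * r) ^ (2 ^ Suc n)) \<le> a 0 * a (2 ^ Suc n)"
        by (simp add: power2_eq_square power_mult_distrib mult_2 power_add mult_ac)
      then show ?case using a0 by simp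
    qed
    have "r ^ n \<le> D / a 0" for n
    proof -
      have "a 0 * r ^ (2 ^ n) * B ^ (2 ^ n) \<le> D * B ^ (2 ^ n)"
        using order_trans[OF low growth, of n] by (simp add: power_mult_distrib mult_ac)
      then have "r ^ (2 ^ n) \<le> D / a 0" using a0 B by (simp add: field_simps)
      moreover have "r ^ n \<le> r ^ (2 ^ n)"
        using r by (intro power_increasing) (simp_all add: less_imp_le)
      ultimately show ?thesis by linarith
    qed
    moreover obtain n where "D / a 0 < r ^ n" using real_arch_pow[OF r] by blast
    ultimately show False by (meson not_less)
  qed
qed

text \<open>A \<open>\<rho>\<close>-map over a unital representation \<open>\<rho>\<close> whose values \<open>\<Psi> x k\<close> are total in the
  target space.\<close>

locale nondegenerate_rho_map = hilbert_module ip act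
  for ip :: "'e::cbanach \<Rightarrow> 'e \<Rightarrow> 'a::unital_cstar_algebra" and act +
  fixes \<rho> :: "'a \<Rightarrow> ('k1::chilbert_space, 'k1) cblinfun"
    and \<Psi> :: "'e \<Rightarrow> ('k1, 'k2::chilbert_space) cblinfun"
  assumes rep: "star_rep cstar_sa \<rho>"
    and one: "\<rho> 1 = cid"
    and rho_map: "rho_map ip \<rho> \<Psi>"
    and nondegenerate: "closure (cspan {\<Psi> x *\<^sub>V k | x k. True}) = UNIV"
begin

lemmas rho = star_rep_cstar[OF rep]

lemma Psi_add: "\<Psi> (x + y) = \<Psi> x + \<Psi> y"
  and Psi_scaleC: "\<Psi> (c *\<^sub>C x) = c *\<^sub>C \<Psi> x"
  and cadj_Psi_Psi: "cadj (\<Psi> x) \<circ>\<^sub>C \<Psi> y = \<rho> (ip x y)"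
  using rho_map by (simp_all add: rho_map_def clinear_add clinear_scaleC)

lemma cinner_Psi: "cinner (\<Psi> x *\<^sub>V k) (\<Psi> y *\<^sub>V l) = cinner k (\<rho> (ip x y) *\<^sub>V l)"
  by (simp add: cinner_cadj flip: cadj_Psi_Psi)

text \<open>Linearity over the algebra is not part of the definition of a \<open>\<rho>\<close>-map; it follows by
  expanding the square norm of the difference.\<close>

lemma Psi_act: "\<Psi> (act x a) = \<Psi> x \<circ>\<^sub>C \<rho> a"
proof (rule cblinfun_eqI)
  fix k
  have "cinner (\<Psi> (act x a) *\<^sub>V k - \<Psi> x *\<^sub>V \<rho> a *\<^sub>V k) (\<Psi> (act x a) *\<^sub>V k - \<Psi> x *\<^sub>V \<rho> a *\<^sub>V k) = 0"
    by (simp add: cinner_diff_left cinner_diff_right cinner_Psi ip_act_left ip_act_right rho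
        flip: cinner_cadj)
  then show "\<Psi> (act x a) *\<^sub>V k = (\<Psi> x \<circ>\<^sub>C \<rho> a) *\<^sub>V k"
    by (simp add: cinner_self_eq_0_iff)
qed

lemma norm_Psi_le: "norm (\<Psi> x *\<^sub>V k) \<le> norm x * norm k"
proof (rule power2_le_imp_le)
  have "complex_of_real ((norm (\<Psi> x *\<^sub>V k))\<^sup>2) = cinner k (\<rho> (ip x x) *\<^sub>V k)"
    by (simp only: cinner_self[symmetric] cinner_Psi)
  then have "(norm (\<Psi> x *\<^sub>V k))\<^sup>2 = cmod (cinner k (\<rho> (ip x x) *\<^sub>V k))"
    by (metis norm_of_real abs_of_nonneg zero_le_power2)
  also have "\<dots> \<le> norm k * norm (\<rho> (ip x x) *\<^sub>V k)" by (rule cinner_Cauchy_Schwarz)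
  also have "\<dots> \<le> norm k * (norm (\<rho> (ip x x)) * norm k)"
    by (intro mult_left_mono norm_capply) simp
  also have "\<dots> \<le> norm k * (norm (ip x x) * norm k)"
    by (intro mult_left_mono mult_right_mono norm_star_rep_le[OF rep one]) simp_all
  finally show "(norm (\<Psi> x *\<^sub>V k))\<^sup>2 \<le> (norm x * norm k)\<^sup>2"
    by (simp add: norm_sq_ip power2_eq_square mult_ac)
qed simp

text \<open>A list of pairs \<open>(x, k)\<close> is a formal sum of tensors \<open>x \<otimes> k\<close>; the operator \<open>w\<close>
  acts on the module components before the sum is mapped to \<open>'k2\<close>.\<close>

definition comb :: "('e, 'e) cblinfun \<Rightarrow> ('e \<times> 'k1) list \<Rightarrow> 'k2" where
  "comb w xs = (\<Sum>(x, k)\<leftarrow>xs. \<Psi> (w *\<^sub>V x) *\<^sub>V k)"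

lemma comb_simps [simp]:
  "comb w [] = 0" "comb w ((x, k) # xs) = \<Psi> (w *\<^sub>V x) *\<^sub>V k + comb w xs"
  by (simp_all add: comb_def)

lemma cinner_comb_move:
  assumes adj: "\<And>x y. ip (u *\<^sub>V x) y = ip x (v *\<^sub>V y)"
  shows "cinner (comb (u \<circ>\<^sub>C w) xs) (comb w' ys) = cinner (comb w xs) (comb (v \<circ>\<^sub>C w') ys)"
proof (induction xs)
  case (Cons p xs)
  obtain x k where p: "p = (x, k)" by (cases p)
  have "cinner (\<Psi> (u *\<^sub>V w *\<^sub>V x) *\<^sub>V k) (comb w' ys) =
      cinner (\<Psi> (w *\<^sub>V x) *\<^sub>V k) (comb (v \<circ>\<^sub>C w') ys)"
    by (induction ys) (auto simp: cinner_add_right cinner_Psi adj)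
  then show ?case using Cons by (simp add: p cinner_add_left)
qed simp

lemma norm_comb_le:
  assumes "\<And>x. norm (w *\<^sub>V x) \<le> C * norm x"
  shows "norm (comb w xs) \<le> (\<Sum>(x, k)\<leftarrow>xs. norm x * norm k) * C"
proof (induction xs)
  case (Cons p xs)
  obtain x k where p: "p = (x, k)" by (cases p)
  have "norm (\<Psi> (w *\<^sub>V x) *\<^sub>V k) \<le> norm (w *\<^sub>V x) * norm k" by (rule norm_Psi_le)
  also have "\<dots> \<le> C * norm x * norm k" by (intro mult_right_mono assms) simp
  finally have "norm (comb w (p # xs)) \<le> C * norm x * norm k + norm (comb w xs)"
    using norm_triangle_ineq[of "\<Psi> (w *\<^sub>V x) *\<^sub>V k" "comb w xs"] by (simp add: p)
  then show ?case using Cons by (simp add: p algebra_simps)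
qed simp

text \<open>For \<open>h = u\<^sup>* u\<close> the numbers \<open>a m = norm (comb (h\<^sup>m) xs)\<close> satisfy
  \<open>(a m)\<^sup>2 \<le> a 0 * a (2 * m)\<close> by the Cauchy--Schwarz inequality, and they grow at most
  geometrically with ratio \<open>B = norm h + 1\<close>. Hence \<open>a 1 \<le> B * a 0\<close>, where \<open>B\<close> does
  not depend on \<open>xs\<close>, and \<open>(norm (comb u xs))\<^sup>2 \<le> a 0 * a 1\<close>.\<close>

lemma comb_bounded:
  assumes "adjointable u"
  shows "\<exists>C\<ge>0. \<forall>xs. norm (comb u xs) \<le> C * norm (comb cid xs)"
proof -
  define v where "v = module_adj ip u"
  define h where "h = v \<circ>\<^sub>C u"
  define P where "P m = (((\<circ>\<^sub>C) h) ^^ m) cid" for m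
  define B where "B = norm h + 1"
  have adj: "ip (u *\<^sub>V x) y = ip x (v *\<^sub>V y)" for x y
    unfolding v_def by (rule ip_module_adj[OF assms])
  have adj': "ip (v *\<^sub>V x) y = ip x (u *\<^sub>V y)" for x y
    unfolding v_def by (rule ip_module_adj'[OF assms])
  have h: "ip (h *\<^sub>V x) y = ip x (h *\<^sub>V y)" for x y
    by (simp add: h_def adj adj')
  have B: "B > 0" by (simp add: B_def add_nonneg_pos)
  have P0: "P 0 = cid" and PSuc: "P (Suc m) = h \<circ>\<^sub>C P m" for m by (simp_all add: P_def)
  have P1: "P 1 = h" unfolding One_nat_def PSuc P0 by (rule cblinfun_eqI) simp
  have move: "cinner (comb (P m) xs) (comb (P n) xs) = cinner (comb (P 0) xs) (comb (P (m + n)) xs)"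
    for m n xs
  proof (induction m arbitrary: n)
    case (Suc m)
    have "cinner (comb (P (Suc m)) xs) (comb (P n) xs) = cinner (comb (P m) xs) (comb (P (Suc n)) xs)"
      unfolding PSuc by (rule cinner_comb_move) (rule h)
    then show ?case using Suc[of "Suc n"] by simp
  qed simp
  have normP: "norm (P m *\<^sub>V x) \<le> B ^ m * norm x" for m x
  proof (induction m)
    case (Suc m)
    have "norm (P (Suc m) *\<^sub>V x) \<le> norm h * norm (P m *\<^sub>V x)" by (simp add: PSuc norm_capply)
    also have "\<dots> \<le> B * (B ^ m * norm x)" by (intro mult_mono Suc) (simp_all add: B_def)
    finally show ?case by (simp add: mult.assoc)
  qed (simp add: P0)
  have one_step: "norm (comb h xs) \<le> B * norm (comb cid xs)" for xs
  proof -
    have "norm (comb (P 1) xs) \<le> B * norm (comb (P 0) xs)"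
    proof (rule subquadratic_growth[OF _ _ _ B])
      fix m
      have "cinner (comb (P 0) xs) (comb (P (2 * m)) xs) = complex_of_real ((norm (comb (P m) xs))\<^sup>2)"
        using move[of m xs m] by (simp add: cinner_self mult_2)
      then have "(norm (comb (P m) xs))\<^sup>2 = cmod (cinner (comb (P 0) xs) (comb (P (2 * m)) xs))"
        by (simp add: norm_power)
      also have "\<dots> \<le> norm (comb (P 0) xs) * norm (comb (P (2 * m)) xs)"
        by (rule cinner_Cauchy_Schwarz)
      finally show "(norm (comb (P m) xs))\<^sup>2 \<le> norm (comb (P 0) xs) * norm (comb (P (2 * m)) xs)" .
      show "norm (comb (P m) xs) \<le> (\<Sum>(x, k)\<leftarrow>xs. norm x * norm k) * B ^ m"
        by (rule norm_comb_le) (rule normP)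
    qed simp
    then show ?thesis by (simp only: P0 P1)
  qed
  have "norm (comb u xs) \<le> sqrt B * norm (comb cid xs)" for xs
  proof -
    have uc: "u \<circ>\<^sub>C cid = u" by (rule cblinfun_eqI) simp
    have "cinner (comb cid xs) (comb h xs) = complex_of_real ((norm (comb u xs))\<^sup>2)"
      using cinner_comb_move[of u v cid xs u xs] adj by (simp add: uc h_def cinner_self)
    then have "(norm (comb u xs))\<^sup>2 = cmod (cinner (comb cid xs) (comb h xs))"
      by (simp add: norm_power)
    also have "\<dots> \<le> norm (comb cid xs) * norm (comb h xs)" by (rule cinner_Cauchy_Schwarz)
    also have "\<dots> \<le> norm (comb cid xs) * (B * norm (comb cid xs))"
      by (intro mult_left_mono one_step) simp
    also have "\<dots> = (sqrt B * norm (comb cid xs))\<^sup>2"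
      using B by (simp add: power_mult_distrib power2_eq_square)
    finally show ?thesis by (rule power2_le_imp_le) (use B in simp)
  qed
  then show ?thesis using B by (intro exI[of _ "sqrt B"]) simp
qed

lemma ex_induced_operator:
  assumes "adjointable u"
  shows "\<exists>S. \<forall>x k. S *\<^sub>V \<Psi> x *\<^sub>V k = \<Psi> (u *\<^sub>V x) *\<^sub>V k"
proof -
  define R where "R = {(\<Psi> x *\<^sub>V k, \<Psi> (u *\<^sub>V x) *\<^sub>V k) | x k. True}"
  obtain C where C: "C \<ge> 0" "\<And>xs. norm (comb u xs) \<le> C * norm (comb cid xs)"
    using comb_bounded[OF assms] by blast
  have "\<exists>xs. z = (comb cid xs, comb u xs)" if "z \<in> cspan R" for z
    using that
  proof (induction rule: cspan_induct)
    case zero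
    show ?case by (intro exI[of _ "[]"]) (simp add: zero_prod_def)
  next
    case (step c z w)
    then obtain x k xs where "z = (\<Psi> x *\<^sub>V k, \<Psi> (u *\<^sub>V x) *\<^sub>V k)" "w = (comb cid xs, comb u xs)"
      unfolding R_def by blast
    then show ?case
      by (intro exI[of _ "(x, c *\<^sub>C k) # xs"]) (simp add: scaleC_prod_def capply_scaleC_right)
  qed
  then have bound: "norm y \<le> C * norm x" if "(x, y) \<in> cspan R" for x y
    using C(2) that by blast
  have "fst ` R = {\<Psi> x *\<^sub>V k | x k. True}" by (force simp: R_def)
  then obtain S where "\<forall>(x, y)\<in>R. S *\<^sub>V x = y"
    using bounded_extension[of R C] bound C(1) nondegenerate by auto
  then have "S *\<^sub>V \<Psi> x *\<^sub>V k = \<Psi> (u *\<^sub>V x) *\<^sub>V k" for x k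
    by (auto simp: R_def)
  then show ?thesis by blast
qed

text \<open>The operator on \<open>'k2\<close> that maps \<open>\<Psi> x k\<close> to \<open>\<Psi> (u x) k\<close>; only meaningful if \<open>u\<close> is adjointable.\<close>

definition induced :: "('e, 'e) cblinfun \<Rightarrow> ('k2, 'k2) cblinfun" where
  "induced u = (SOME S. \<forall>x k. S *\<^sub>V \<Psi> x *\<^sub>V k = \<Psi> (u *\<^sub>V x) *\<^sub>V k)"

lemma induced_apply:
  assumes "adjointable u"
  shows "induced u *\<^sub>V \<Psi> x *\<^sub>V k = \<Psi> (u *\<^sub>V x) *\<^sub>V k"
  using someI_ex[OF ex_induced_operator[OF assms]] unfolding induced_def by blast

lemma eq_on_PsiI:
  assumes "\<And>x k. S *\<^sub>V \<Psi> x *\<^sub>V k = T *\<^sub>V \<Psi> x *\<^sub>V k"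
  shows "S = T"
  by (rule cblinfun_eq_on_dense[OF nondegenerate]) (use assms in blast)

lemma induced_Psi: "adjointable u \<Longrightarrow> induced u \<circ>\<^sub>C \<Psi> x = \<Psi> (u *\<^sub>V x)"
  by (rule cblinfun_eqI) (simp add: induced_apply)

lemma induced_add:
  "adjointable u \<Longrightarrow> adjointable v \<Longrightarrow> induced (u + v) = induced u + induced v"
  by (rule eq_on_PsiI) (simp add: induced_apply adjointable_add capply_add Psi_add)

lemma induced_scaleC: "adjointable u \<Longrightarrow> induced (c *\<^sub>C u) = c *\<^sub>C induced u"
  by (rule eq_on_PsiI) (simp add: induced_apply adjointable_scaleC capply_scaleC Psi_scaleC)

lemma induced_ccompose:
  "adjointable u \<Longrightarrow> adjointable v \<Longrightarrow> induced (u \<circ>\<^sub>C v) = induced u \<circ>\<^sub>C induced v"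
  by (rule eq_on_PsiI) (simp add: induced_apply adjointable_ccompose)

lemma induced_module_adj:
  assumes "adjointable u"
  shows "induced (module_adj ip u) = cadj (induced u)"
proof (rule eq_on_PsiI)
  fix x k
  show "induced (module_adj ip u) *\<^sub>V \<Psi> x *\<^sub>V k = cadj (induced u) *\<^sub>V \<Psi> x *\<^sub>V k"
  proof (rule cinner_eq_on_dense[OF nondegenerate])
    fix z assume "z \<in> {\<Psi> x *\<^sub>V k | x k. True}"
    then obtain y l where z: "z = \<Psi> y *\<^sub>V l" by blast
    show "cinner (induced (module_adj ip u) *\<^sub>V \<Psi> x *\<^sub>V k) z = cinner (cadj (induced u) *\<^sub>V \<Psi> x *\<^sub>V k) z"
      by (simp add: z cinner_cadj' induced_apply assms adjointable_module_adj cinner_Psi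
          ip_module_adj')
  qed
qed

lemma induced_rank_one: "induced (rank_one ip act x y) = \<Psi> x \<circ>\<^sub>C cadj (\<Psi> y)"
proof (rule eq_on_PsiI)
  fix z k
  have "cadj (\<Psi> y) *\<^sub>V \<Psi> z *\<^sub>V k = \<rho> (ip y z) *\<^sub>V k" by (simp flip: cadj_Psi_Psi)
  then show "induced (rank_one ip act x y) *\<^sub>V \<Psi> z *\<^sub>V k = (\<Psi> x \<circ>\<^sub>C cadj (\<Psi> y)) *\<^sub>V \<Psi> z *\<^sub>V k"
    by (simp add: induced_apply adjointable_rank_one rank_one_apply Psi_act)
qed

lemma star_rep_induced: "star_rep (compact1_sa ip act) induced"
  by (auto simp: star_rep_def compact1_sa_def adjointable_compact_ops1 induced_add induced_scaleC
      induced_ccompose induced_module_adj)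

text \<open>A representation with the prescribed values on rank-one operators is determined, since
  an operator \<open>D\<close> with \<open>D \<Psi>(x) \<Psi>(x)\<^sup>* = 0\<close> satisfies
  \<open>(D \<Psi>(x)) (D \<Psi>(x))\<^sup>* = 0\<close> and hence vanishes on the range of \<open>\<Psi> x\<close>.\<close>

lemma unique_induced_rep_induced: "unique_induced_rep ip act \<Psi> induced"
  unfolding unique_induced_rep_def
proof (intro conjI allI impI ballI)
  show "induced_rep ip act \<Psi> induced"
    by (simp add: induced_rep_def star_rep_induced induced_rank_one)
  fix \<sigma>' u
  assume s: "induced_rep ip act \<Psi> \<sigma>'" and u: "u \<in> compact_ops1 ip act"
  have adj: "adjointable u" by (rule adjointable_compact_ops1[OF u])
  have D: "(\<sigma>' u - induced u) \<circ>\<^sub>C \<Psi> x = 0" for x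
  proof (rule cadj_ccompose_eq_0)
    have rank_one: "u \<circ>\<^sub>C rank_one ip act x x = rank_one ip act (u *\<^sub>V x) x"
    proof (rule cblinfun_eqI)
      fix z
      have "ip w (u *\<^sub>V act x a) = ip w (act (u *\<^sub>V x) a)" for w a
        by (simp add: ip_act_right flip: ip_module_adj'[OF adj])
      then have "u *\<^sub>V act x a = act (u *\<^sub>V x) a" for a by (rule ip_eqI)
      then show "(u \<circ>\<^sub>C rank_one ip act x x) *\<^sub>V z = rank_one ip act (u *\<^sub>V x) x *\<^sub>V z"
        by (simp add: rank_one_apply)
    qed
    have "\<sigma>' u \<circ>\<^sub>C (\<Psi> x \<circ>\<^sub>C cadj (\<Psi> x)) = \<sigma>' u \<circ>\<^sub>C \<sigma>' (rank_one ip act x x)"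
      using s by (simp add: induced_rep_def)
    also have "\<dots> = \<sigma>' (u \<circ>\<^sub>C rank_one ip act x x)"
      using s u rank_one_in_compact_ops1 by (simp add: induced_rep_def star_rep_def compact1_sa_def)
    also have "\<dots> = \<Psi> (u *\<^sub>V x) \<circ>\<^sub>C cadj (\<Psi> x)"
      using s by (simp add: induced_rep_def rank_one)
    finally have eq: "\<sigma>' u *\<^sub>V \<Psi> x *\<^sub>V cadj (\<Psi> x) *\<^sub>V k = \<Psi> (u *\<^sub>V x) *\<^sub>V cadj (\<Psi> x) *\<^sub>V k" for k
      by (metis capply_ccompose)
    show "(\<sigma>' u - induced u) \<circ>\<^sub>C \<Psi> x \<circ>\<^sub>C cadj ((\<sigma>' u - induced u) \<circ>\<^sub>C \<Psi> x) = 0"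
      by (rule cblinfun_eqI) (simp add: cadj_ccompose capply_diff eq induced_apply[OF adj])
  qed
  show "\<sigma>' u = induced u"
  proof (rule eq_on_PsiI)
    fix x k
    have "(\<sigma>' u - induced u) *\<^sub>V \<Psi> x *\<^sub>V k = 0"
      using arg_cong[OF D[of x], of "\<lambda>T. T *\<^sub>V k"] by simp
    then show "\<sigma>' u *\<^sub>V \<Psi> x *\<^sub>V k = induced u *\<^sub>V \<Psi> x *\<^sub>V k" by (simp add: capply_diff)
  qed
qed

end

section \<open>Operator matrices and the linking algebra\<close>

lemma block_ccompose:
  "block A B C D \<circ>\<^sub>C block A' B' C' D' =
    block (A \<circ>\<^sub>C A' + B \<circ>\<^sub>C C') (A \<circ>\<^sub>C B' + B \<circ>\<^sub>C D') (C \<circ>\<^sub>C A' + D \<circ>\<^sub>C C') (C \<circ>\<^sub>C B' + D \<circ>\<^sub>C D')"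
proof (rule cblinfun_eqI)
  fix z
  show "(block A B C D \<circ>\<^sub>C block A' B' C' D') *\<^sub>V z =
    block (A \<circ>\<^sub>C A' + B \<circ>\<^sub>C C') (A \<circ>\<^sub>C B' + B \<circ>\<^sub>C D') (C \<circ>\<^sub>C A' + D \<circ>\<^sub>C C') (C \<circ>\<^sub>C B' + D \<circ>\<^sub>C D') *\<^sub>V z"
    by (cases z) (simp add: block_apply capply_add capply_add_right)
qed

lemma block_add: "block A B C D + block A' B' C' D' = block (A + A') (B + B') (C + C') (D + D')"
proof (rule cblinfun_eqI)
  fix z
  show "(block A B C D + block A' B' C' D') *\<^sub>V z = block (A + A') (B + B') (C + C') (D + D') *\<^sub>V z"
    by (cases z) (simp add: block_apply capply_add)
qed

lemma block_scaleC: "c *\<^sub>C block A B C D = block (c *\<^sub>C A) (c *\<^sub>C B) (c *\<^sub>C C) (c *\<^sub>C D)"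
proof (rule cblinfun_eqI)
  fix z
  show "(c *\<^sub>C block A B C D) *\<^sub>V z = block (c *\<^sub>C A) (c *\<^sub>C B) (c *\<^sub>C C) (c *\<^sub>C D) *\<^sub>V z"
    by (cases z) (simp add: block_apply capply_scaleC scaleC_prod_def scaleC_add_right)
qed

lemma cadj_block: "cadj (block A B C D) = block (cadj A) (cadj C) (cadj B) (cadj D)"
proof (rule cadjI)
  fix x y
  show "cinner (block A B C D *\<^sub>V x) y =
      cinner x (block (cadj A) (cadj C) (cadj B) (cadj D) *\<^sub>V y)"
    by (cases x; cases y)
      (simp add: block_apply cinner_prod_def cinner_add_left cinner_add_right cinner_cadj)
qed

lemma block_cid: "block cid 0 0 cid = cid"
proof (rule cblinfun_eqI)
  fix z
  show "block cid 0 0 cid *\<^sub>V z = cid *\<^sub>V z"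
    by (cases z) (simp add: block_apply)
qed

lemma ccompose_zero [simp]: "T \<circ>\<^sub>C 0 = 0" "0 \<circ>\<^sub>C T = 0"
  by (rule cblinfun_eqI; simp)+

lemma cunitary_block_diag: "cunitary S \<Longrightarrow> cunitary T \<Longrightarrow> cunitary (block S 0 0 T)"
  by (simp add: cunitary_def cadj_block block_ccompose block_cid)

lemma (in nondegenerate_rho_map) star_rep_block_rep:
  "star_rep (linking_sa ip act) (block_rep induced \<Psi> \<rho>)"
  unfolding star_rep_def
proof (intro conjI ballI allI)
  fix s t
  assume "s \<in> sa_carrier (linking_sa ip act)" "t \<in> sa_carrier (linking_sa ip act)"
  then obtain u x y a u' x' y' a' where st: "s = (u, x, y, a)" "t = (u', x', y', a')"
    and "u \<in> compact_ops1 ip act" "u' \<in> compact_ops1 ip act"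
    by (auto simp: linking_sa_def)
  then have adj: "adjointable u" "adjointable u'" by (simp_all add: adjointable_compact_ops1)
  show "block_rep induced \<Psi> \<rho> (sa_add (linking_sa ip act) s t) =
      block_rep induced \<Psi> \<rho> s + block_rep induced \<Psi> \<rho> t"
    by (simp add: st linking_sa_def block_rep_def block_add induced_add adj Psi_add cadj_add rho)
  have "cadj (\<Psi> (module_adj ip u' *\<^sub>V y)) = cadj (\<Psi> y) \<circ>\<^sub>C induced u'"
    by (simp add: adj adjointable_module_adj induced_module_adj cadj_ccompose flip: induced_Psi)
  then show "block_rep induced \<Psi> \<rho> (sa_mult (linking_sa ip act) s t) =
      block_rep induced \<Psi> \<rho> s \<circ>\<^sub>C block_rep induced \<Psi> \<rho> t"
    by (simp add: st linking_sa_def block_rep_def block_ccompose induced_add adj Psi_add Psi_act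
        cadj_add cadj_ccompose rho induced_ccompose adjointable_ccompose adjointable_rank_one
        induced_rank_one induced_Psi cadj_Psi_Psi)
next
  fix c s
  assume "s \<in> sa_carrier (linking_sa ip act)"
  then show "block_rep induced \<Psi> \<rho> (sa_scale (linking_sa ip act) c s) = c *\<^sub>C block_rep induced \<Psi> \<rho> s"
    by (auto simp: linking_sa_def block_rep_def block_scaleC induced_scaleC
        adjointable_compact_ops1 Psi_scaleC cadj_scaleC rho)
next
  fix s
  assume "s \<in> sa_carrier (linking_sa ip act)"
  then show "block_rep induced \<Psi> \<rho> (sa_star (linking_sa ip act) s) = cadj (block_rep induced \<Psi> \<rho> s)"
    by (auto simp: linking_sa_def block_rep_def cadj_block induced_module_adj
        adjointable_compact_ops1 rho)
qed

section \<open>Comparison of two minimal dilation pairs\<close>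

lemma cunitary_apply:
  assumes "cunitary T"
  shows "cadj T *\<^sub>V T *\<^sub>V x = x" "T *\<^sub>V cadj T *\<^sub>V y = y"
  using assms unfolding cunitary_def by (metis capply_ccompose capply_cid)+

lemma cinner_cunitary: "cunitary T \<Longrightarrow> cinner (T *\<^sub>V x) (T *\<^sub>V y) = cinner x y"
  by (simp add: cinner_cadj cunitary_apply)

text \<open>Uniqueness of the minimal Stinespring dilation.\<close>

lemma Stinespring_unique:
  assumes rep: "star_rep cstar_sa \<rho>" "star_rep cstar_sa \<pi>"
    and one: "\<rho> 1 = cid" "\<pi> 1 = cid"
    and dilation: "\<And>a. cadj V \<circ>\<^sub>C \<rho> a \<circ>\<^sub>C V = cadj U \<circ>\<^sub>C \<pi> a \<circ>\<^sub>C U"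
    and total: "closure (cspan {\<rho> a *\<^sub>V V *\<^sub>V h | a h. True}) = UNIV"
      "closure (cspan {\<pi> a *\<^sub>V U *\<^sub>V h | a h. True}) = UNIV"
  shows "\<exists>T. cunitary T \<and> T \<circ>\<^sub>C V = U \<and> (\<forall>a. T \<circ>\<^sub>C \<rho> a = \<pi> a \<circ>\<^sub>C T)"
proof -
  have moment: "cinner (\<rho> a *\<^sub>V V *\<^sub>V h) (\<rho> b *\<^sub>V V *\<^sub>V g) =
      cinner (\<pi> a *\<^sub>V U *\<^sub>V h) (\<pi> b *\<^sub>V U *\<^sub>V g)" for a b h g
  proof -
    have "cinner (\<rho> a *\<^sub>V V *\<^sub>V h) (\<rho> b *\<^sub>V V *\<^sub>V g) =
        cinner h ((cadj V \<circ>\<^sub>C \<rho> (star a * b) \<circ>\<^sub>C V) *\<^sub>V g)"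
      by (simp add: star_rep_cstar[OF rep(1)] cinner_cadj)
    also have "\<dots> = cinner (\<pi> a *\<^sub>V U *\<^sub>V h) (\<pi> b *\<^sub>V U *\<^sub>V g)"
      unfolding dilation by (simp add: star_rep_cstar[OF rep(2)] cinner_cadj)
    finally show ?thesis .
  qed
  have "\<exists>T. cunitary T \<and> (\<forall>i. T *\<^sub>V (\<lambda>(a, h). \<rho> a *\<^sub>V V *\<^sub>V h) i = (\<lambda>(a, h). \<pi> a *\<^sub>V U *\<^sub>V h) i)"
  proof (rule unitary_of_equal_Gram)
    have "range (\<lambda>(a, h). \<rho> a *\<^sub>V V *\<^sub>V h) = {\<rho> a *\<^sub>V V *\<^sub>V h | a h. True}"
      "range (\<lambda>(a, h). \<pi> a *\<^sub>V U *\<^sub>V h) = {\<pi> a *\<^sub>V U *\<^sub>V h | a h. True}" by auto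
    then show "closure (cspan (range (\<lambda>(a, h). \<rho> a *\<^sub>V V *\<^sub>V h))) = UNIV"
      "closure (cspan (range (\<lambda>(a, h). \<pi> a *\<^sub>V U *\<^sub>V h))) = UNIV" using total by simp_all
  qed (auto simp: moment)
  then obtain T where T: "cunitary T" and T_gen: "\<And>a h. T *\<^sub>V \<rho> a *\<^sub>V V *\<^sub>V h = \<pi> a *\<^sub>V U *\<^sub>V h"
    by auto
  have "T \<circ>\<^sub>C V = U"
    by (rule cblinfun_eqI) (use T_gen[of 1] one in simp)
  moreover have "T \<circ>\<^sub>C \<rho> a = \<pi> a \<circ>\<^sub>C T" for a
  proof (rule cblinfun_eq_on_dense[OF total(1)])
    fix z assume "z \<in> {\<rho> a *\<^sub>V V *\<^sub>V h | a h. True}"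
    then obtain b h where z: "z = \<rho> b *\<^sub>V V *\<^sub>V h" by blast
    have "T *\<^sub>V \<rho> a *\<^sub>V \<rho> b *\<^sub>V V *\<^sub>V h = T *\<^sub>V \<rho> (a * b) *\<^sub>V V *\<^sub>V h"
      by (simp add: star_rep_cstar[OF rep(1)])
    also have "\<dots> = \<pi> a *\<^sub>V \<pi> b *\<^sub>V U *\<^sub>V h"
      unfolding T_gen by (simp add: star_rep_cstar[OF rep(2)])
    finally show "(T \<circ>\<^sub>C \<rho> a) *\<^sub>V z = (\<pi> a \<circ>\<^sub>C T) *\<^sub>V z" by (simp add: z T_gen)
  qed
  ultimately show ?thesis using T by blast
qed

lemma unitary_between_rho_maps:
  assumes "nondegenerate_rho_map ip act \<rho> \<Psi>" and "nondegenerate_rho_map ip act \<pi> \<Gamma>"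
    and T: "cunitary T" "\<And>a. T \<circ>\<^sub>C \<rho> a = \<pi> a \<circ>\<^sub>C T"
  shows "\<exists>T'. cunitary T' \<and> (\<forall>x. T' \<circ>\<^sub>C \<Psi> x = \<Gamma> x \<circ>\<^sub>C T)"
proof -
  interpret P: nondegenerate_rho_map ip act \<rho> \<Psi> by fact
  interpret G: nondegenerate_rho_map ip act \<pi> \<Gamma> by fact
  have T_rho: "\<pi> a *\<^sub>V T *\<^sub>V k = T *\<^sub>V \<rho> a *\<^sub>V k" for a k by (metis T(2) capply_ccompose)
  have "\<exists>T'. cunitary T' \<and> (\<forall>i. T' *\<^sub>V (\<lambda>(x, k). \<Psi> x *\<^sub>V k) i = (\<lambda>(x, k). \<Gamma> x *\<^sub>V T *\<^sub>V k) i)"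
  proof (rule unitary_of_equal_Gram)
    have "range (\<lambda>(x, k). \<Psi> x *\<^sub>V k) = {\<Psi> x *\<^sub>V k | x k. True}" by auto
    then show "closure (cspan (range (\<lambda>(x, k). \<Psi> x *\<^sub>V k))) = UNIV" using P.nondegenerate by simp
    have "\<Gamma> x *\<^sub>V l \<in> range (\<lambda>(x, k). \<Gamma> x *\<^sub>V T *\<^sub>V k)" for x l
      by (rule range_eqI[of _ _ "(x, cadj T *\<^sub>V l)"]) (simp add: cunitary_apply[OF T(1)])
    then have "range (\<lambda>(x, k). \<Gamma> x *\<^sub>V T *\<^sub>V k) = {\<Gamma> x *\<^sub>V l | x l. True}" by auto
    then show "closure (cspan (range (\<lambda>(x, k). \<Gamma> x *\<^sub>V T *\<^sub>V k))) = UNIV" using G.nondegenerate by simp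
  qed (auto simp: P.cinner_Psi G.cinner_Psi T_rho cinner_cunitary[OF T(1)])
  then obtain T' where "cunitary T'" and "\<And>x k. T' *\<^sub>V \<Psi> x *\<^sub>V k = \<Gamma> x *\<^sub>V T *\<^sub>V k" by auto
  then show ?thesis by (intro exI[of _ T']) (auto intro: cblinfun_eqI)
qed

theorem theorem4p4:
  fixes ip :: "'e::cbanach \<Rightarrow> 'e \<Rightarrow> 'a::unital_cstar_algebra"
    and act :: "'e \<Rightarrow> 'a \<Rightarrow> 'e"
    and \<phi> :: "'a \<Rightarrow> ('h1::chilbert_space, 'h1) cblinfun"
    and \<Phi> :: "'e \<Rightarrow> ('h1, 'h2::chilbert_space) cblinfun"
    and \<rho> :: "'a \<Rightarrow> ('k1::chilbert_space, 'k1) cblinfun"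
    and V :: "('h1, 'k1) cblinfun"
    and \<Psi> :: "'e \<Rightarrow> ('k1, 'k2::chilbert_space) cblinfun"
    and W :: "('h2, 'k2) cblinfun"
    and \<pi> :: "'a \<Rightarrow> ('l1::chilbert_space, 'l1) cblinfun"
    and U :: "('h1, 'l1) cblinfun"
    and \<Gamma> :: "'e \<Rightarrow> ('l1, 'l2::chilbert_space) cblinfun"
    and S :: "('h2, 'l2) cblinfun"
  assumes "hilbert_module ip act"
    and "completely_positive \<phi>"
    and "completely_semi_map ip \<phi> \<Phi>"
    and "minimal_dilation_pair ip \<phi> \<Phi> \<rho> V \<Psi> W"
    and "minimal_dilation_pair ip \<phi> \<Phi> \<pi> U \<Gamma> S"
  shows "\<exists>\<sigma> \<tau>. unique_induced_rep ip act \<Psi> \<sigma> \<and> unique_induced_rep ip act \<Gamma> \<tau> \<and>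
    (\<exists>T1 T2. cunitary T1 \<and> cunitary T2 \<and>
      T1 \<circ>\<^sub>C V = U \<and> (\<forall>a. T1 \<circ>\<^sub>C \<rho> a = \<pi> a \<circ>\<^sub>C T1) \<and>
      T2 \<circ>\<^sub>C W = S \<and> (\<forall>x. T2 \<circ>\<^sub>C \<Psi> x = \<Gamma> x \<circ>\<^sub>C T1) \<and>
      block T2 0 0 T1 \<circ>\<^sub>C block W 0 0 V = block S 0 0 U \<and>
      (\<forall>l\<in>sa_carrier (linking_sa ip act).
         block T2 0 0 T1 \<circ>\<^sub>C block_rep \<sigma> \<Psi> \<rho> l \<circ>\<^sub>C block (cadj T2) 0 0 (cadj T1) =
         block_rep \<tau> \<Gamma> \<pi> l)) \<and>
    unitarily_equivalent cstar_sa \<rho> \<pi> \<and>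
    unitarily_equivalent (linking_sa ip act) (block_rep \<sigma> \<Psi> \<rho>) (block_rep \<tau> \<Gamma> \<pi>) \<and>
    unitarily_equivalent (compact1_sa ip act) \<sigma> \<tau>"
proof -
  interpret hilbert_module ip act by fact
  have nP: "nondegenerate_rho_map ip act \<rho> \<Psi>" and nG: "nondegenerate_rho_map ip act \<pi> \<Gamma>"
    using assms(4,5)
    by unfold_locales (simp_all add: minimal_dilation_pair_def dilation_pair_def)
  interpret P: nondegenerate_rho_map ip act \<rho> \<Psi> by (rule nP)
  interpret G: nondegenerate_rho_map ip act \<pi> \<Gamma> by (rule nG)
  have totalV: "closure (cspan {\<rho> a *\<^sub>V V *\<^sub>V h | a h. True}) = UNIV"
    and totalU: "closure (cspan {\<pi> a *\<^sub>V U *\<^sub>V h | a h. True}) = UNIV"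
    and phi: "\<And>a. \<phi> a = cadj V \<circ>\<^sub>C \<rho> a \<circ>\<^sub>C V" "\<And>a. \<phi> a = cadj U \<circ>\<^sub>C \<pi> a \<circ>\<^sub>C U"
    and Phi: "\<And>x. \<Phi> x = cadj W \<circ>\<^sub>C \<Psi> x \<circ>\<^sub>C V" "\<And>x. \<Phi> x = cadj S \<circ>\<^sub>C \<Gamma> x \<circ>\<^sub>C U"
    using assms(4,5) by (simp_all add: minimal_dilation_pair_def dilation_pair_def)
  have "cadj V \<circ>\<^sub>C \<rho> a \<circ>\<^sub>C V = cadj U \<circ>\<^sub>C \<pi> a \<circ>\<^sub>C U" for a using phi by metis
  then obtain T1 where T1: "cunitary T1" "T1 \<circ>\<^sub>C V = U" and T1_rho: "\<And>a. T1 \<circ>\<^sub>C \<rho> a = \<pi> a \<circ>\<^sub>C T1"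
    using Stinespring_unique[OF P.rep G.rep P.one G.one _ totalV totalU] by blast
  obtain T2 where T2: "cunitary T2" and T2_Psi: "\<And>x. T2 \<circ>\<^sub>C \<Psi> x = \<Gamma> x \<circ>\<^sub>C T1"
    using unitary_between_rho_maps[OF nP nG T1(1) T1_rho] by blast
  have T1_V: "T1 *\<^sub>V V *\<^sub>V h = U *\<^sub>V h" for h by (metis T1(2) capply_ccompose)
  have T1_rho': "T1 *\<^sub>V \<rho> a *\<^sub>V k = \<pi> a *\<^sub>V T1 *\<^sub>V k" for a k by (metis T1_rho capply_ccompose)
  have T2_Psi': "T2 *\<^sub>V \<Psi> x *\<^sub>V k = \<Gamma> x *\<^sub>V T1 *\<^sub>V k" for x k by (metis T2_Psi capply_ccompose)
  have T2_W: "T2 \<circ>\<^sub>C W = S"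
  proof -
    \<comment> \<open>The adjoint identity is tested on the total vectors \<open>\<Psi> x (\<rho> a (V h)) = \<Psi> (x a) (V h)\<close>.\<close>
    have "cadj S \<circ>\<^sub>C T2 = cadj W"
    proof (rule P.eq_on_PsiI)
      fix x k
      have "cadj S \<circ>\<^sub>C T2 \<circ>\<^sub>C \<Psi> x = cadj W \<circ>\<^sub>C \<Psi> x"
      proof (rule cblinfun_eq_on_dense[OF totalV])
        fix z assume "z \<in> {\<rho> a *\<^sub>V V *\<^sub>V h | a h. True}"
        then obtain a h where z: "z = \<rho> a *\<^sub>V V *\<^sub>V h" by blast
        have "cadj S *\<^sub>V \<Gamma> (act x a) *\<^sub>V U *\<^sub>V h = cadj W *\<^sub>V \<Psi> (act x a) *\<^sub>V V *\<^sub>V h"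
          by (metis Phi capply_ccompose)
        then show "(cadj S \<circ>\<^sub>C T2 \<circ>\<^sub>C \<Psi> x) *\<^sub>V z = (cadj W \<circ>\<^sub>C \<Psi> x) *\<^sub>V z"
          by (simp add: z T2_Psi' T1_rho' T1_V P.Psi_act G.Psi_act)
      qed
      then show "(cadj S \<circ>\<^sub>C T2) *\<^sub>V \<Psi> x *\<^sub>V k = cadj W *\<^sub>V \<Psi> x *\<^sub>V k"
        by (metis capply_ccompose)
    qed
    then have "W = cadj T2 \<circ>\<^sub>C S" by (metis cadj_cadj cadj_ccompose)
    then show ?thesis by (intro cblinfun_eqI) (simp add: cunitary_apply[OF T2])
  qed
  have rho: "T1 \<circ>\<^sub>C \<rho> a \<circ>\<^sub>C cadj T1 = \<pi> a" for a
    by (rule cblinfun_eqI) (simp add: T1_rho' cunitary_apply[OF T1(1)])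
  have Psi: "T2 \<circ>\<^sub>C \<Psi> x \<circ>\<^sub>C cadj T1 = \<Gamma> x" for x
    by (rule cblinfun_eqI) (simp add: T2_Psi' cunitary_apply[OF T1(1)])
  have cadj_Psi: "T1 \<circ>\<^sub>C cadj (\<Psi> x) \<circ>\<^sub>C cadj T2 = cadj (\<Gamma> x)" for x
    by (rule cblinfun_eqI) (simp add: cadj_ccompose flip: Psi)
  have sigma: "T2 \<circ>\<^sub>C P.induced u \<circ>\<^sub>C cadj T2 = G.induced u" if "u \<in> compact_ops1 ip act" for u
  proof -
    have adj: "adjointable u" by (rule adjointable_compact_ops1[OF that])
    have "T2 \<circ>\<^sub>C P.induced u = G.induced u \<circ>\<^sub>C T2"
      by (rule P.eq_on_PsiI)
        (simp add: T2_Psi' P.induced_apply[OF adj] G.induced_apply[OF adj])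
    then have "T2 *\<^sub>V P.induced u *\<^sub>V z = G.induced u *\<^sub>V T2 *\<^sub>V z" for z by (metis capply_ccompose)
    then show ?thesis by (intro cblinfun_eqI) (simp add: cunitary_apply[OF T2])
  qed
  have linking: "block T2 0 0 T1 \<circ>\<^sub>C block_rep P.induced \<Psi> \<rho> l \<circ>\<^sub>C block (cadj T2) 0 0 (cadj T1) =
      block_rep G.induced \<Gamma> \<pi> l" if "l \<in> sa_carrier (linking_sa ip act)" for l
    using that
    by (auto simp: linking_sa_def block_rep_def block_ccompose sigma rho Psi cadj_Psi)
  have columns: "block T2 0 0 T1 \<circ>\<^sub>C block W 0 0 V = block S 0 0 U"
    by (simp add: block_ccompose T1 T2_W)
  have "unitarily_equivalent cstar_sa \<rho> \<pi>"
    unfolding unitarily_equivalent_def using P.rep G.rep T1(1) rho by blast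
  moreover have "unitarily_equivalent (compact1_sa ip act) P.induced G.induced"
    unfolding unitarily_equivalent_def
    using P.star_rep_induced G.star_rep_induced T2 sigma by (auto simp: compact1_sa_def)
  moreover have "unitarily_equivalent (linking_sa ip act) (block_rep P.induced \<Psi> \<rho>) (block_rep G.induced \<Gamma> \<pi>)"
    unfolding unitarily_equivalent_def
    using P.star_rep_block_rep G.star_rep_block_rep cunitary_block_diag[OF T2 T1(1)] linking
    by (auto simp: cadj_block intro!: exI[of _ "block T2 0 0 T1"])
  ultimately show ?thesis
    using P.unique_induced_rep_induced G.unique_induced_rep_induced T1 T2 T1_rho T2_W T2_Psi
      columns linking by blast
qed

end
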